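(* Let $n\ge 3$ and $r\ge 2$ be integers with $r<\sqrt[3]{\frac{n}{100\ln n}}$. Then $$d(n,r)\geq\frac{1}{40r^3}\left(\frac{n}{\ln n}\right)^{\frac {r-1}{r}}\left(\frac{r}{r-1}\right)^{n}.$$
   Context: A hypergraph $H=(V,E)$ is $n$-uniform if every edge has exactly $n$ vertices. A vertex $r$-coloring of $H$ is a map $V\to\{1,\dots,r\}$; it is panchromatic if every edge of $H$ contains at least one vertex of each of the $r$ colors. The degree of an edge $A$ of $H$ is the number of edges of $H$ intersecting $A$, and the maximal edge degree of $H$ is the maximum of the degrees of its edges. $d(n,r)$ denotes the minimum possible value of the maximal edge degree of an $n$-uniform hypergraph that does not admit a panchromatic coloring with $r$ colors. *)

theory Defs
  imports Complex_Main "HOL-Library.FuncSet"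
begin

definition hypergraph :: "'a set \<Rightarrow> 'a set set \<Rightarrow> bool" where
  "hypergraph V E \<longleftrightarrow> finite V \<and> E \<subseteq> Pow V"

definition uniform :: "nat \<Rightarrow> 'a set set \<Rightarrow> bool" where
  "uniform n E \<longleftrightarrow> (\<forall>A\<in>E. card A = n)"

definition panchromatic :: "'a set set \<Rightarrow> nat \<Rightarrow> ('a \<Rightarrow> nat) \<Rightarrow> bool" where
  "panchromatic E r f \<longleftrightarrow> (\<forall>A\<in>E. \<forall>c\<in>{1..r}. \<exists>v\<in>A. f v = c)"

definition panchromatic_colorable :: "'a set \<Rightarrow> 'a set set \<Rightarrow> nat \<Rightarrow> bool" where
  "panchromatic_colorable V E r \<longleftrightarrow> (\<exists>f \<in> V \<rightarrow> {1..r}. panchromatic E r f)"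

text \<open>A nonempty edge intersects itself, so it is counted in its own degree.\<close>

definition edge_degree :: "'a set set \<Rightarrow> 'a set \<Rightarrow> nat" where
  "edge_degree E A = card {B \<in> E. B \<inter> A \<noteq> {}}"

text \<open>Meaningful only for a nonempty set of edges; a hypergraph without edges is
  panchromatically colorable with any \<open>r \<ge> 1\<close> colors, so it plays no role in \<open>d n r\<close> below.\<close>

definition max_edge_degree :: "'a set set \<Rightarrow> nat" where
  "max_edge_degree E = Max (edge_degree E ` E)"

text \<open>Taking the vertices among the natural numbers is no restriction for finite hypergraphs;
  see \<open>d_le_max_edge_degree\<close>.\<close>

definition d :: "nat \<Rightarrow> nat \<Rightarrow> nat" where
  "d n r = (LEAST D. \<exists>(V :: nat set) E. hypergraph V E \<and> uniform n E \<and>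
      \<not> panchromatic_colorable V E r \<and> max_edge_degree E = D)"

lemma d_le_max_edge_degree:
  fixes V :: "'a set"
  assumes H: "hypergraph V E" and U: "uniform n E" and N: "\<not> panchromatic_colorable V E r"
  shows "d n r \<le> max_edge_degree E"
proof -
  have fin: "finite V" and sub: "\<And>A. A \<in> E \<Longrightarrow> A \<subseteq> V"
    using H by (auto simp: hypergraph_def)
  obtain g :: "'a \<Rightarrow> nat" where g: "inj_on g V"
    using finite_imp_inj_to_nat_seg[OF fin] by blast
  define F where "F = (`) g ` E"
  have injE: "inj_on ((`) g) E"
    by (rule inj_onI) (meson sub inj_on_image_eq_iff[OF g])
  have H': "hypergraph (g ` V) F"
    unfolding hypergraph_def F_def using fin sub by blast
  have U': "uniform n F"
    using U sub g unfolding uniform_def F_def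
    by (metis (no_types, lifting) card_image imageE inj_on_subset)
  have N': "\<not> panchromatic_colorable (g ` V) F r"
  proof
    assume "panchromatic_colorable (g ` V) F r"
    then obtain f where f: "f \<in> g ` V \<rightarrow> {1..r}" "panchromatic F r f"
      by (auto simp: panchromatic_colorable_def)
    have "f \<circ> g \<in> V \<rightarrow> {1..r}" using f(1) by auto
    moreover have "panchromatic E r (f \<circ> g)"
      using f(2) by (auto simp: panchromatic_def F_def)
    ultimately show False using N by (auto simp: panchromatic_colorable_def)
  qed
  have deg: "edge_degree F (g ` A) = edge_degree E A" if "A \<in> E" for A
  proof -
    have "g ` B \<inter> g ` A \<noteq> {} \<longleftrightarrow> B \<inter> A \<noteq> {}" if "B \<in> E" for B
      using inj_on_image_Int[OF g sub[OF that] sub[OF \<open>A \<in> E\<close>]] by (metis image_is_empty)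
    then have "{B \<in> F. B \<inter> g ` A \<noteq> {}} = (`) g ` {B \<in> E. B \<inter> A \<noteq> {}}"
      by (auto simp: F_def)
    then show ?thesis
      unfolding edge_degree_def by (simp add: card_image inj_on_subset[OF injE])
  qed
  have "edge_degree F ` F = edge_degree E ` E"
    using deg by (subst (2) F_def) (simp add: image_image)
  then have "max_edge_degree F = max_edge_degree E"
    by (simp add: max_edge_degree_def)
  then show ?thesis
    unfolding d_def using H' U' N' by (intro Least_le) blast
qed

end

theory Submission
  imports Defs "HOL-Probability.Probability"
begin

text \<open>
  Every vertex receives an independent random position in a line that is cut into blocks
  \<open>\<Delta>\<^sub>1, \<delta>\<^sub>1, \<Delta>\<^sub>2, \<dots>, \<delta>\<^sub>r\<^sub>-\<^sub>1, \<Delta>\<^sub>r\<close>. A vertex in \<open>\<Delta>\<^sub>i\<close> gets colour \<open>i\<close>; a vertex in \<open>\<delta>\<^sub>i\<close> gets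
  colour \<open>i\<close> if it is the first vertex of \<open>\<delta>\<^sub>i\<close> in some edge that would otherwise miss colour \<open>i\<close>,
  and colour \<open>i + 1\<close> otherwise. If an edge misses colour \<open>i\<close>, following the reasons downwards
  yields a chain of edges \<open>e\<^sub>k, \<dots>, e\<^sub>i\<close> and vertices \<open>v\<^sub>j \<in> e\<^sub>j \<inter> e\<^sub>j\<^sub>+\<^sub>1\<close> in \<open>\<delta>\<^sub>j\<close> such that \<open>e\<^sub>j\<close> has no
  vertex strictly between \<open>v\<^sub>j\<^sub>-\<^sub>1\<close> and \<open>v\<^sub>j\<close>. The avoided intervals are disjoint, and their total length
  is at least about \<open>(i - k + 1) / r\<close>, which makes a chain of \<open>t\<close> edges so unlikely that the local
  lemma applies: \<open>D\<^sup>t\<close> times its probability is at most \<open>r\<^sup>-\<^sup>3 9\<^sup>-\<^sup>t\<close>, where \<open>D\<close> bounds the edge degrees.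
  The vertices \<open>v\<^sub>j\<close> cost a factor \<open>h q\<^sup>h\<close> with \<open>h = |e\<^sub>j \<inter> e\<^sub>j\<^sub>+\<^sub>1|\<close> and \<open>q < 1\<close> rather than \<open>h\<close>, because
  a common vertex has to avoid two intervals at once.
\<close>

subsection \<open>Independence and the local lemma\<close>

lemma prob_pair_pmf_Times:
  "measure_pmf.prob (pair_pmf M N) (A \<times> B) = measure_pmf.prob M A * measure_pmf.prob N B"
proof -
  \<comment> \<open>Restricting to the supports changes no probability and makes both sets
    countable, as \<open>measure_pmf_prob_product\<close> requires.\<close>
  have "measure_pmf.prob (pair_pmf M N) (A \<times> B)
      = measure_pmf.prob (pair_pmf M N) ((A \<inter> set_pmf M) \<times> (B \<inter> set_pmf N))"
    by (rule measure_prob_cong_0) (auto simp: pmf_pair set_pmf_iff)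
  also have "\<dots> = measure_pmf.prob M (A \<inter> set_pmf M) * measure_pmf.prob N (B \<inter> set_pmf N)"
    by (rule measure_pmf_prob_product) auto
  finally show ?thesis
    by (simp add: measure_Int_set_pmf)
qed

text \<open>Independent positions split into their parts on \<open>U\<close> and on
  \<open>V - U\<close>, and in these coordinates the two events form a product set. The local lemma
  uses this with \<open>U\<close> the vertices of one chain.\<close>

lemma prob_Pi_pmf_Int_indep:
  assumes "finite V" "U \<subseteq> V"
    and A: "\<And>\<sigma> \<sigma>'. (\<And>u. u \<in> U \<Longrightarrow> \<sigma> u = \<sigma>' u) \<Longrightarrow> \<sigma> \<in> A \<longleftrightarrow> \<sigma>' \<in> A"
    and B: "\<And>\<sigma> \<sigma>'. (\<And>u. u \<in> V - U \<Longrightarrow> \<sigma> u = \<sigma>' u) \<Longrightarrow> \<sigma> \<in> B \<longleftrightarrow> \<sigma>' \<in> B"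
  shows "measure_pmf.prob (Pi_pmf V c p) (A \<inter> B)
    = measure_pmf.prob (Pi_pmf V c p) A * measure_pmf.prob (Pi_pmf V c p) B"
proof -
  define h where "h = (\<lambda>(f, g) x. if x \<in> U then f x else g x :: 'b)"
  have split: "Pi_pmf V c p = map_pmf h (pair_pmf (Pi_pmf U c p) (Pi_pmf (V - U) c p))"
    using assms(1,2) Pi_pmf_union[of U "V - U" c p]
    by (simp add: h_def finite_subset Un_absorb1)
  have inA: "h (f, g) \<in> A \<longleftrightarrow> f \<in> A" for f g
    by (rule A) (auto simp: h_def)
  have inB: "h (f, g) \<in> B \<longleftrightarrow> g \<in> B" for f g
    by (rule B) (auto simp: h_def)
  have "h -` (A \<inter> B) = A \<times> B" "h -` A = A \<times> UNIV" "h -` B = UNIV \<times> B"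
    using inA inB by auto
  then show ?thesis
    unfolding split measure_map_pmf by (simp add: prob_pair_pmf_Times)
qed

text \<open>Conditioning on the avoidance of other events at most doubles the probability of each
  event. The hypothesis bounds a sum over neighbours rather than their number, because chains of
  different lengths have very different probabilities; by \<open>refl\<close> the sum covers
  \<open>A i\<close> itself.\<close>

lemma lovasz_local_lemma:
  fixes A :: "'i \<Rightarrow> 'b set"
  assumes "finite I"
    and refl: "\<And>i. i \<in> I \<Longrightarrow> N i i"
    and indep: "\<And>i S. i \<in> I \<Longrightarrow> S \<subseteq> I \<Longrightarrow> (\<And>j. j \<in> S \<Longrightarrow> \<not> N i j) \<Longrightarrow>
        measure_pmf.prob P (A i \<inter> {\<omega>. \<forall>j\<in>S. \<omega> \<notin> A j})
        = measure_pmf.prob P (A i) * measure_pmf.prob P {\<omega>. \<forall>j\<in>S. \<omega> \<notin> A j}"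
    and small: "\<And>i. i \<in> I \<Longrightarrow> (\<Sum>j | j \<in> I \<and> N i j. measure_pmf.prob P (A j)) \<le> 1 / 4"
  shows "\<exists>\<omega>\<in>set_pmf P. \<forall>i\<in>I. \<omega> \<notin> A i"
proof -
  let ?pr = "measure_pmf.prob P"
  define G where "G S = {\<omega>. \<forall>j\<in>S. \<omega> \<notin> A j}" for S
  \<comment> \<open>A bound on a conditional probability, multiplied out so that it makes sense
    before \<open>G S\<close> is known to have positive probability.\<close>
  have key: "?pr (A i \<inter> G S) \<le> 2 * ?pr (A i) * ?pr (G S)" if "i \<in> I" "S \<subseteq> I" for i S
    using finite_subset[OF that(2) \<open>finite I\<close>] that
  proof (induction S arbitrary: i rule: finite_psubset_induct)
    case (psubset S)
    define S1 where "S1 = {j \<in> S. N i j}"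
    define S2 where "S2 = S - S1"
    have finS1: "finite S1" using psubset.hyps S1_def by auto
    have ind: "?pr (A i \<inter> G S2) = ?pr (A i) * ?pr (G S2)"
      unfolding G_def by (rule indep) (use psubset.prems in \<open>auto simp: S1_def S2_def\<close>)
    show ?case
    proof (cases "S1 = {}")
      case True
      then have "S2 = S" by (simp add: S2_def)
      then show ?thesis using ind by (simp add: mult_nonneg_nonneg)
    next
      case False
      then have "S2 \<subset> S" by (auto simp: S1_def S2_def)
      have IH: "?pr (A j \<inter> G S2) \<le> 2 * ?pr (A j) * ?pr (G S2)" if "j \<in> S1" for j
        using psubset.IH[OF \<open>S2 \<subset> S\<close>] psubset.prems that by (auto simp: S1_def S2_def)
      have "?pr (G S2) \<le> ?pr (G S \<union> (\<Union>j\<in>S1. A j \<inter> G S2))"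
        by (rule measure_pmf.finite_measure_mono) (auto simp: G_def S2_def)
      also have "\<dots> \<le> ?pr (G S) + ?pr (\<Union>j\<in>S1. A j \<inter> G S2)"
        by (rule measure_Un_le) auto
      also have "?pr (\<Union>j\<in>S1. A j \<inter> G S2) \<le> (\<Sum>j\<in>S1. ?pr (A j \<inter> G S2))"
        by (rule measure_pmf.finite_measure_subadditive_finite) (use finS1 in auto)
      also have "\<dots> \<le> (\<Sum>j\<in>S1. 2 * ?pr (A j) * ?pr (G S2))"
        by (rule sum_mono) (rule IH)
      also have "\<dots> = 2 * (\<Sum>j\<in>S1. ?pr (A j)) * ?pr (G S2)"
        by (simp add: sum_distrib_left sum_distrib_right)
      also have "\<dots> \<le> 2 * (1 / 4) * ?pr (G S2)"
      proof (intro mult_right_mono mult_left_mono)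
        have "(\<Sum>j\<in>S1. ?pr (A j)) \<le> (\<Sum>j | j \<in> I \<and> N i j. ?pr (A j))"
          by (rule sum_mono2) (use \<open>finite I\<close> psubset.prems in \<open>auto simp: S1_def\<close>)
        then show "(\<Sum>j\<in>S1. ?pr (A j)) \<le> 1 / 4" using small psubset.prems by force
      qed auto
      \<comment> \<open>Once the far events are avoided, the near ones together take away at most
        half of the probability.\<close>
      finally have half: "?pr (G S2) \<le> 2 * ?pr (G S)" by simp
      have "?pr (A i \<inter> G S) \<le> ?pr (A i \<inter> G S2)"
        by (rule measure_pmf.finite_measure_mono) (auto simp: G_def S2_def)
      also have "\<dots> \<le> ?pr (A i) * (2 * ?pr (G S))"
        unfolding ind using half by (intro mult_left_mono) auto
      finally show ?thesis by simp
    qed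
  qed
  \<comment> \<open>Events are added one at a time, and each addition keeps at least half of the
    probability.\<close>
  have "?pr (G S) > 0" if "S \<subseteq> I" for S
    using finite_subset[OF that \<open>finite I\<close>] that
  proof (induction S rule: finite_induct)
    case empty
    then show ?case by (simp add: G_def)
  next
    case (insert i S)
    then have i: "i \<in> I" "S \<subseteq> I" and pos: "?pr (G S) > 0" by auto
    have "?pr (A i) \<le> (\<Sum>j | j \<in> I \<and> N i j. ?pr (A j))"
      by (rule member_le_sum) (use i refl \<open>finite I\<close> in auto)
    then have le: "?pr (A i) \<le> 1 / 4" using small i by force
    have "?pr (G S) \<le> ?pr (G (insert i S) \<union> (A i \<inter> G S))"
      by (rule measure_pmf.finite_measure_mono) (auto simp: G_def)
    also have "\<dots> \<le> ?pr (G (insert i S)) + ?pr (A i \<inter> G S)"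
      by (rule measure_Un_le) auto
    also have "?pr (A i \<inter> G S) \<le> 2 * (1 / 4) * ?pr (G S)"
      using key[OF i] le mult_right_mono[OF le, of "?pr (G S)"] by simp
    finally show ?case using pos by simp
  qed
  then have "?pr (G I \<inter> set_pmf P) > 0" by (simp add: measure_Int_set_pmf)
  then have "G I \<inter> set_pmf P \<noteq> {}" by (metis less_irrefl measure_empty)
  then show ?thesis by (auto simp: G_def)
qed

text \<open>Here \<open>S\<close> stands for the edges of a chain through one vertex and
  \<open>l j\<close> for the mass that edge \<open>j\<close> avoids. With \<open>L\<close> the sum
  of the earlier values and \<open>x\<close> the last one, \<open>1 - L - x\<close> falls short of
  \<open>(1 - L) * (1 - x)\<close> by \<open>L * x\<close>. For two adjacent indices this is at
  least \<open>lam\<^sup>2\<close>, which yields the factor \<open>q < 1\<close> per common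
  vertex.\<close>

lemma one_minus_sum_le_prod:
  fixes l :: "nat \<Rightarrow> real"
  assumes lam: "0 \<le> lam" and l: "\<And>j. j \<in> S \<Longrightarrow> lam \<le> l j"
    and S: "S \<subseteq> {k..m}" and le1: "sum l S \<le> 1"
  shows "1 - sum l S \<le> (\<Prod>j\<in>S. 1 - l j) * (1 - lam\<^sup>2) ^ card {j \<in> S. Suc j \<in> S}"
  using l S le1
proof (induction m arbitrary: S)
  case 0
  then have "S = {} \<or> S = {0}" by auto
  then show ?case by auto
next
  case (Suc m)
  show ?case
  proof (cases "Suc m \<in> S")
    case False
    then have "S \<subseteq> {k..m}" using Suc.prems(2) by (force simp: le_Suc_eq)
    then show ?thesis using Suc by blast
  next
    case True
    define S' where "S' = S - {Suc m}"
    have fin: "finite S" using Suc.prems(2) finite_subset by blast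
    have S': "S' \<subseteq> {k..m}" using Suc.prems(2) by (force simp: S'_def le_Suc_eq)
    have finS': "finite S'" using fin by (simp add: S'_def)
    define L where "L = sum l S'"
    define x where "x = l (Suc m)"
    define q where "q = 1 - lam\<^sup>2"
    define c where "c = card {j \<in> S'. Suc j \<in> S'}"
    have sumS: "sum l S = L + x"
      using True fin by (simp add: L_def x_def S'_def sum_diff1)
    have prodS: "(\<Prod>j\<in>S. 1 - l j) = (1 - x) * (\<Prod>j\<in>S'. 1 - l j)"
      using True fin by (simp add: x_def S'_def prod.remove)
    have x: "lam \<le> x" using Suc.prems(1) True by (simp add: x_def)
    have L0: "0 \<le> L" unfolding L_def
      by (rule sum_nonneg) (use Suc.prems(1) lam in \<open>force simp: S'_def\<close>)
    have Lx: "L + x \<le> 1" using Suc.prems(3) sumS by simp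
    have "L \<le> 1" "x \<le> 1" "0 \<le> x" using Lx L0 x lam by auto
    have "lam \<le> 1" using x \<open>x \<le> 1\<close> by simp
    then have q: "0 \<le> q" "q \<le> 1" using lam by (auto simp: q_def power_le_one)
    have IH: "1 - L \<le> (\<Prod>j\<in>S'. 1 - l j) * q ^ c"
      unfolding L_def q_def c_def
      by (rule Suc.IH) (use S' Suc.prems(1) \<open>L \<le> 1\<close> in \<open>auto simp: S'_def L_def\<close>)
    show ?thesis
    proof (cases "m \<in> S")
      case False
      have "{j \<in> S. Suc j \<in> S} = {j \<in> S'. Suc j \<in> S'}"
        using False Suc.prems(2) by (auto simp: S'_def)
      then have c: "card {j \<in> S. Suc j \<in> S} = c" by (simp add: c_def)
      have "1 - (L + x) \<le> (1 - x) * (1 - L)"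
        using L0 \<open>0 \<le> x\<close> by (simp add: algebra_simps)
      also have "\<dots> \<le> (1 - x) * ((\<Prod>j\<in>S'. 1 - l j) * q ^ c)"
        using IH \<open>x \<le> 1\<close> by (intro mult_left_mono) auto
      finally show ?thesis
        by (simp add: sumS prodS c q_def mult.assoc)
    next
      case m: True
      have "{j \<in> S. Suc j \<in> S} = insert m {j \<in> S'. Suc j \<in> S'}"
        using m True Suc.prems(2) by (auto simp: S'_def)
      moreover have "m \<notin> {j \<in> S'. Suc j \<in> S'}" by (auto simp: S'_def)
      ultimately have c: "card {j \<in> S. Suc j \<in> S} = Suc c"
        using finS' by (simp add: c_def)
      have "lam \<le> l m" using Suc.prems(1) m by simp
      also have "l m \<le> L" unfolding L_def
        by (rule member_le_sum) (use m finS' Suc.prems(1) lam in \<open>force simp: S'_def\<close>)+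
      finally have lamL: "lam \<le> L" .
      have "lam\<^sup>2 \<le> L * x"
        unfolding power2_eq_square using lamL x lam by (intro mult_mono) auto
      moreover have "(1 - x) * (1 - L) \<le> 1"
        using L0 \<open>0 \<le> x\<close> \<open>x \<le> 1\<close> \<open>L \<le> 1\<close> by (intro mult_le_one) auto
      moreover have "0 \<le> (1 - x) * (1 - L)" using \<open>x \<le> 1\<close> \<open>L \<le> 1\<close> by simp
      ultimately have "(1 - x) * (1 - L) * lam\<^sup>2 \<le> L * x"
        using mult_mono[of "(1 - x) * (1 - L)" 1 "lam\<^sup>2" "L * x"] L0 \<open>0 \<le> x\<close> by simp
      then have "1 - (L + x) \<le> (1 - x) * (1 - L) * q"
        by (simp add: q_def algebra_simps)
      also have "\<dots> = (1 - L) * ((1 - x) * q)" by simp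
      also have "\<dots> \<le> ((\<Prod>j\<in>S'. 1 - l j) * q ^ c) * ((1 - x) * q)"
        using IH \<open>x \<le> 1\<close> q by (intro mult_right_mono) auto
      finally show ?thesis
        by (simp add: sumS prodS c q_def mult_ac)
    qed
  qed
qed

subsection \<open>The colouring and its chains\<close>

text \<open>Positions are natural numbers: \<open>\<Delta>\<^sub>i\<close> is the single point \<open>i * B\<close>, and \<open>\<delta>\<^sub>i\<close> is
  \<open>{i * B<..<Suc i * B}\<close>. The predicate \<open>needs\<close> says that edge \<open>e\<close> receives colour \<open>i\<close> neither
  from \<open>\<Delta>\<^sub>i\<close> nor from \<open>\<delta>\<^sub>i\<^sub>-\<^sub>1\<close>. Ties within \<open>\<delta>\<^sub>i\<close> are harmless: all vertices of \<open>f\<close> at its least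
  position in \<open>\<delta>\<^sub>i\<close> keep colour \<open>i\<close>.\<close>

fun needs :: "nat \<Rightarrow> 'a set set \<Rightarrow> ('a \<Rightarrow> nat) \<Rightarrow> nat \<Rightarrow> 'a set \<Rightarrow> bool" where
  "needs B E \<sigma> 0 e \<longleftrightarrow> False"
| "needs B E \<sigma> (Suc i) e \<longleftrightarrow> (\<forall>u\<in>e. \<sigma> u \<noteq> Suc i * B) \<and>
     (\<forall>v\<in>e. \<sigma> v \<in> {i * B<..<Suc i * B} \<longrightarrow>
        (\<exists>f\<in>E. v \<in> f \<and> needs B E \<sigma> i f \<and>
           (\<forall>u\<in>f. \<sigma> u \<in> {i * B<..<Suc i * B} \<longrightarrow> \<sigma> v \<le> \<sigma> u)))"

definition keeps :: "nat \<Rightarrow> 'a set set \<Rightarrow> ('a \<Rightarrow> nat) \<Rightarrow> nat \<Rightarrow> 'a \<Rightarrow> bool" where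
  "keeps B E \<sigma> i v \<longleftrightarrow> (\<exists>f\<in>E. v \<in> f \<and> needs B E \<sigma> i f \<and>
     (\<forall>u\<in>f. \<sigma> u \<in> {i * B<..<Suc i * B} \<longrightarrow> \<sigma> v \<le> \<sigma> u))"

definition chain_coloring :: "nat \<Rightarrow> 'a set set \<Rightarrow> ('a \<Rightarrow> nat) \<Rightarrow> 'a \<Rightarrow> nat" where
  "chain_coloring B E \<sigma> v =
     (if B dvd \<sigma> v \<or> keeps B E \<sigma> (\<sigma> v div B) v then \<sigma> v div B else Suc (\<sigma> v div B))"

text \<open>The end points of the avoided intervals of a chain with edges indexed by \<open>k..i\<close>: edge \<open>j\<close> avoids
  the open interval from \<open>gap (j - 1)\<close> to \<open>gap j\<close>, where \<open>x j\<close> is the position of the vertex linking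
  the edges \<open>j\<close> and \<open>j + 1\<close>.\<close>

definition gap :: "nat \<Rightarrow> nat \<Rightarrow> nat \<Rightarrow> (nat \<Rightarrow> nat) \<Rightarrow> nat \<Rightarrow> nat" where
  "gap B k i x j = (if j < k then j * B else if j < i then x j else Suc j * B)"

text \<open>The linking vertices are chosen inside the event, so a chain is indexed by its edges
  alone and the event reads only the positions of their vertices.\<close>

definition chain_event :: "nat \<Rightarrow> nat \<Rightarrow> nat \<Rightarrow> (nat \<Rightarrow> 'a set) \<Rightarrow> ('a \<Rightarrow> nat) set" where
  "chain_event B k i es = {\<sigma>. \<exists>vs.
     (\<forall>j\<in>{k..<i}. vs j \<in> es j \<inter> es (Suc j) \<and> \<sigma> (vs j) \<in> {j * B<..<Suc j * B}) \<and>
     (\<forall>j\<in>{k..i}. \<forall>u\<in>es j. \<sigma> u \<notin> {gap B k i (\<sigma> \<circ> vs) (j - 1)<..<gap B k i (\<sigma> \<circ> vs) j})}"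

text \<open>Extensional functions, so that a chain is determined by its edges and chains can be
  counted.\<close>

definition edge_chains :: "'a set set \<Rightarrow> nat \<Rightarrow> nat \<Rightarrow> (nat \<Rightarrow> 'a set) set" where
  "edge_chains E k i = {es \<in> {k..i} \<rightarrow>\<^sub>E E. \<forall>j\<in>{k..<i}. es j \<inter> es (Suc j) \<noteq> {}}"

text \<open>Induction on the colour. The last vertex \<open>v\<close> of \<open>e\<close> in the
  block below kept its colour because of an edge \<open>f\<close> that needs this colour and has no
  vertex of the block before \<open>v\<close>; \<open>e\<close> is appended to the chain of
  \<open>f\<close>. The interval of the last edge only reaches \<open>i * B\<close>, since its right
  end is known only with the next link.\<close>

lemma needs_imp_chain:
  assumes "needs B E \<sigma> i e" "e \<in> E" and fin: "\<And>e. e \<in> E \<Longrightarrow> finite e"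
  shows "\<exists>k es vs. 1 \<le> k \<and> k \<le> i \<and> (\<forall>j\<in>{k..i}. es j \<in> E) \<and> es i = e \<and>
    (\<forall>j\<in>{k..<i}. vs j \<in> es j \<inter> es (Suc j) \<and> \<sigma> (vs j) \<in> {j * B<..<Suc j * B}) \<and>
    (\<forall>j\<in>{k..<i}. \<forall>u\<in>es j. \<sigma> u \<notin> {gap B k i (\<sigma> \<circ> vs) (j - 1)<..<gap B k i (\<sigma> \<circ> vs) j}) \<and>
    (\<forall>u\<in>e. \<sigma> u \<notin> {gap B k i (\<sigma> \<circ> vs) (i - 1)<..i * B})"
  using assms(1,2)
proof (induction i arbitrary: e)
  case 0
  then show ?case by simp
next
  case (Suc i)
  note e = Suc.prems
  show ?case
  proof (cases "\<exists>v\<in>e. \<sigma> v \<in> {i * B<..<Suc i * B}")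
    case False
    have "\<sigma> u \<notin> {i * B<..Suc i * B}" if "u \<in> e" for u
      using False e(1) that by (auto simp: le_less)
    \<comment> \<open>The chain starts here: with \<open>k = Suc i\<close>, the value of
      \<open>gap\<close> at \<open>i\<close> is \<open>i * B\<close>.\<close>
    then show ?thesis
      using e by (intro exI[of _ "Suc i"] exI[of _ "\<lambda>_. e"]) (auto simp: gap_def)
  next
    case True
    define W where "W = {v \<in> e. \<sigma> v \<in> {i * B<..<Suc i * B}}"
    have "finite W" "W \<noteq> {}" using True fin[OF e(2)] by (auto simp: W_def)
    then have "Max (\<sigma> ` W) \<in> \<sigma> ` W" by simp
    then obtain v where v: "v \<in> W" "\<sigma> v = Max (\<sigma> ` W)" by auto
    have vW: "\<sigma> u \<le> \<sigma> v" if "u \<in> W" for u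
      using v(2) \<open>finite W\<close> that by simp
    have ve: "v \<in> e" "\<sigma> v \<in> {i * B<..<Suc i * B}" using v(1) by (auto simp: W_def)
    then obtain f where f: "f \<in> E" "v \<in> f" "needs B E \<sigma> i f"
      and fmin: "\<And>u. u \<in> f \<Longrightarrow> \<sigma> u \<in> {i * B<..<Suc i * B} \<Longrightarrow> \<sigma> v \<le> \<sigma> u"
      using e(1) unfolding needs.simps by blast
    obtain k es vs where k: "1 \<le> k" "k \<le> i" and es: "\<And>j. j \<in> {k..i} \<Longrightarrow> es j \<in> E" "es i = f"
      and vs: "\<And>j. j \<in> {k..<i} \<Longrightarrow> vs j \<in> es j \<inter> es (Suc j) \<and> \<sigma> (vs j) \<in> {j * B<..<Suc j * B}"
      and av: "\<And>j u. j \<in> {k..<i} \<Longrightarrow> u \<in> es j \<Longrightarrow>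
        \<sigma> u \<notin> {gap B k i (\<sigma> \<circ> vs) (j - 1)<..<gap B k i (\<sigma> \<circ> vs) j}"
      and top: "\<And>u. u \<in> f \<Longrightarrow> \<sigma> u \<notin> {gap B k i (\<sigma> \<circ> vs) (i - 1)<..i * B}"
      using Suc.IH[OF f(3,1)] by blast
    define es' where "es' = es(Suc i := e)"
    define vs' where "vs' = vs(i := v)"
    have gap_eq: "gap B k (Suc i) (\<sigma> \<circ> vs') j = gap B k i (\<sigma> \<circ> vs) j" if "j < i" for j
      using that by (simp add: gap_def vs'_def)
    have gap_i: "gap B k (Suc i) (\<sigma> \<circ> vs') i = \<sigma> v"
      using k by (simp add: gap_def vs'_def)
    have "\<forall>j\<in>{k..Suc i}. es' j \<in> E" "es' (Suc i) = e"
      using es e(2) by (auto simp: es'_def le_Suc_eq)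
    moreover have "vs' j \<in> es' j \<inter> es' (Suc j) \<and> \<sigma> (vs' j) \<in> {j * B<..<Suc j * B}"
      if "j \<in> {k..<Suc i}" for j
    proof (cases "j = i")
      case True
      then show ?thesis using ve f(2) es(2) by (auto simp: vs'_def es'_def)
    next
      case False
      then show ?thesis using vs[of j] that by (auto simp: vs'_def es'_def)
    qed
    moreover have "\<sigma> u \<notin> {gap B k (Suc i) (\<sigma> \<circ> vs') (j - 1)<..<gap B k (Suc i) (\<sigma> \<circ> vs') j}"
      if "j \<in> {k..<Suc i}" "u \<in> es' j" for j u
    proof (cases "j = i")
      case True
      then have "u \<in> f" using that es(2) by (auto simp: es'_def)
      have g: "gap B k (Suc i) (\<sigma> \<circ> vs') (i - 1) = gap B k i (\<sigma> \<circ> vs) (i - 1)"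
        using k by (intro gap_eq) auto
      \<comment> \<open>Up to \<open>i * B\<close> the induction hypothesis excludes
        \<open>u\<close>; beyond it the minimality of \<open>v\<close> in \<open>f\<close>
        does.\<close>
      have "\<not> (gap B k i (\<sigma> \<circ> vs) (i - 1) < \<sigma> u \<and> \<sigma> u < \<sigma> v)"
        using top[OF \<open>u \<in> f\<close>] fmin[OF \<open>u \<in> f\<close>] ve(2)
        by (metis greaterThanAtMost_iff greaterThanLessThan_iff leD less_trans not_le)
      then show ?thesis using True g gap_i by auto
    next
      case False
      then have "j < i" "u \<in> es j" using that by (auto simp: es'_def)
      then show ?thesis using av[of j u] that by (simp add: gap_eq)
    qed
    moreover have "\<sigma> u \<notin> {gap B k (Suc i) (\<sigma> \<circ> vs') (Suc i - 1)<..Suc i * B}" if "u \<in> e" for u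
    proof
      assume "\<sigma> u \<in> {gap B k (Suc i) (\<sigma> \<circ> vs') (Suc i - 1)<..Suc i * B}"
      then have "\<sigma> v < \<sigma> u" "\<sigma> u \<le> Suc i * B" using gap_i by auto
      moreover have "\<sigma> u \<noteq> Suc i * B" using e(1) that by auto
      ultimately have "u \<in> W" using that ve(2) by (auto simp: W_def)
      then show False using vW \<open>\<sigma> v < \<sigma> u\<close> by fastforce
    qed
    moreover have "1 \<le> k" "k \<le> Suc i" using k by auto
    ultimately show ?thesis by blast
  qed
qed

text \<open>An edge that misses \<open>c\<close> satisfies \<open>needs\<close> by the colouring
  rule, and it has no vertex in the block above \<open>c * B\<close> either, so the last interval of
  its chain extends to \<open>Suc c * B\<close>.\<close>

lemma panchromatic_chain_coloring:
  assumes "0 < B" and fin: "\<And>e. e \<in> E \<Longrightarrow> finite e"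
    and no: "\<And>k i es. 1 \<le> k \<Longrightarrow> k \<le> i \<Longrightarrow> i \<le> r \<Longrightarrow> es \<in> edge_chains E k i \<Longrightarrow> \<sigma> \<notin> chain_event B k i es"
  shows "panchromatic E r (chain_coloring B E \<sigma>)"
  unfolding panchromatic_def
proof (intro ballI, rule ccontr)
  fix e c assume e: "e \<in> E" and c: "c \<in> {1..r}"
    and miss: "\<not> (\<exists>v\<in>e. chain_coloring B E \<sigma> v = c)"
  have div: "t div B = i \<and> \<not> B dvd t" if "t \<in> {i * B<..<Suc i * B}" for t i
  proof -
    have "t div B = i"
      using that \<open>0 < B\<close> by (intro div_nat_eqI) (auto simp: mult.commute)
    moreover have "\<not> B dvd t"
      using that \<open>t div B = i\<close> by (metis dvd_div_mult_self greaterThanLessThan_iff less_irrefl)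
    ultimately show ?thesis by blast
  qed
  obtain i where i: "c = Suc i" using c by (cases c) auto
  have needs: "needs B E \<sigma> c e"
    unfolding i needs.simps
  proof (intro conjI ballI impI)
    fix u assume "u \<in> e"
    show "\<sigma> u \<noteq> Suc i * B"
    proof
      assume "\<sigma> u = Suc i * B"
      then have "B dvd \<sigma> u" "\<sigma> u div B = Suc i" using \<open>0 < B\<close> by (simp_all only: dvd_triv_right) auto
      then have "chain_coloring B E \<sigma> u = c" by (simp add: chain_coloring_def i)
      then show False using miss \<open>u \<in> e\<close> by blast
    qed
  next
    fix v assume v: "v \<in> e" "\<sigma> v \<in> {i * B<..<Suc i * B}"
    have "chain_coloring B E \<sigma> v \<noteq> Suc i" using miss v(1) i by blast
    then have "keeps B E \<sigma> i v"
      using div[OF v(2)] by (auto simp: chain_coloring_def split: if_splits)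
    then show "\<exists>f\<in>E. v \<in> f \<and> needs B E \<sigma> i f \<and> (\<forall>u\<in>f. \<sigma> u \<in> {i * B<..<Suc i * B} \<longrightarrow> \<sigma> v \<le> \<sigma> u)"
      by (simp only: keeps_def)
  qed
  \<comment> \<open>The first such vertex would keep colour \<open>c\<close>, with \<open>e\<close>
    itself as the reason.\<close>
  have empty: "\<sigma> u \<notin> {c * B<..<Suc c * B}" if "u \<in> e" for u
  proof
    assume u: "\<sigma> u \<in> {c * B<..<Suc c * B}"
    define W where "W = {v \<in> e. \<sigma> v \<in> {c * B<..<Suc c * B}}"
    have "finite W" "W \<noteq> {}" using u that fin[OF e] by (auto simp: W_def)
    then have "Min (\<sigma> ` W) \<in> \<sigma> ` W" by simp
    then obtain v where v: "v \<in> W" "\<sigma> v = Min (\<sigma> ` W)" by auto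
    have vW: "\<sigma> v \<le> \<sigma> u" if "u \<in> W" for u
      using v(2) \<open>finite W\<close> that by simp
    have ve: "v \<in> e" "\<sigma> v \<in> {c * B<..<Suc c * B}" using v(1) by (auto simp: W_def)
    have "keeps B E \<sigma> c v"
      unfolding keeps_def using e needs ve vW by (auto simp: W_def intro!: bexI[of _ e])
    then have "chain_coloring B E \<sigma> v = c"
      using div[OF ve(2)] by (simp add: chain_coloring_def)
    then show False using miss ve(1) by blast
  qed
  obtain k es vs where k: "1 \<le> k" "k \<le> c" and es: "\<And>j. j \<in> {k..c} \<Longrightarrow> es j \<in> E" "es c = e"
    and vs: "\<And>j. j \<in> {k..<c} \<Longrightarrow> vs j \<in> es j \<inter> es (Suc j) \<and> \<sigma> (vs j) \<in> {j * B<..<Suc j * B}"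
    and av: "\<And>j u. j \<in> {k..<c} \<Longrightarrow> u \<in> es j \<Longrightarrow>
        \<sigma> u \<notin> {gap B k c (\<sigma> \<circ> vs) (j - 1)<..<gap B k c (\<sigma> \<circ> vs) j}"
    and top: "\<And>u. u \<in> e \<Longrightarrow> \<sigma> u \<notin> {gap B k c (\<sigma> \<circ> vs) (c - 1)<..c * B}"
    using needs_imp_chain[OF needs e fin] by blast
  define es' where "es' = restrict es {k..c}"
  have "es' \<in> edge_chains E k c"
    unfolding edge_chains_def
  proof (intro CollectI conjI ballI)
    show "es' \<in> {k..c} \<rightarrow>\<^sub>E E" using es by (auto simp: es'_def)
    show "es' j \<inter> es' (Suc j) \<noteq> {}" if "j \<in> {k..<c}" for j
      using vs[OF that] that by (auto simp: es'_def)
  qed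
  moreover have "\<sigma> \<in> chain_event B k c es'"
    unfolding chain_event_def
  proof (intro CollectI exI[of _ vs] conjI ballI)
    show "vs j \<in> es' j \<inter> es' (Suc j)" "\<sigma> (vs j) \<in> {j * B<..<Suc j * B}" if "j \<in> {k..<c}" for j
      using vs[OF that] that by (auto simp: es'_def)
    show "\<sigma> u \<notin> {gap B k c (\<sigma> \<circ> vs) (j - 1)<..<gap B k c (\<sigma> \<circ> vs) j}"
      if "j \<in> {k..c}" "u \<in> es' j" for j u
    proof (cases "j = c")
      case True
      then have "u \<in> e" using that es by (auto simp: es'_def)
      moreover have "gap B k c (\<sigma> \<circ> vs) c = Suc c * B" using k by (simp add: gap_def)
      ultimately show ?thesis
        using top[of u] empty[of u] True
        by (metis greaterThanAtMost_iff greaterThanLessThan_iff linorder_not_le)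
    next
      case False
      then show ?thesis using av[of j u] that by (auto simp: es'_def)
    qed
  qed
  ultimately show False using no k c by auto
qed

lemma chain_coloring_range:
  assumes "0 < B" "\<sigma> v \<in> {B..r * B}"
  shows "chain_coloring B E \<sigma> v \<in> {1..r}"
proof -
  have "1 \<le> \<sigma> v div B"
    using div_le_mono[of B "\<sigma> v" B] assms by simp
  moreover have le: "\<sigma> v div B \<le> r"
    using div_le_mono[of "\<sigma> v" "r * B" B] assms by simp
  \<comment> \<open>In the given range only \<open>r * B\<close> has quotient \<open>r\<close>; as a
    multiple of \<open>B\<close> it receives \<open>r\<close> and not \<open>r + 1\<close>.\<close>
  moreover have "B dvd \<sigma> v" if "\<sigma> v div B = r"
  proof -
    have "r * B \<le> \<sigma> v" using that div_times_less_eq_dividend[of "\<sigma> v" B] by simp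
    then have "\<sigma> v = r * B" using assms by simp
    then show ?thesis by simp
  qed
  ultimately show ?thesis by (fastforce simp: chain_coloring_def)
qed

subsection \<open>Counting chains\<close>

lemma finite_edge_chains: "finite E \<Longrightarrow> finite (edge_chains E k i)"
  by (rule finite_subset[of _ "{k..i} \<rightarrow>\<^sub>E E"]) (auto simp: edge_chains_def intro!: finite_PiE)

lemma edge_chains_eqI:
  assumes "f \<in> edge_chains E k i" "g \<in> edge_chains E k i" "\<And>t. t \<in> {k..i} \<Longrightarrow> f t = g t"
  shows "f = g"
  using assms PiE_ext[of f "{k..i}" "\<lambda>_. E" g] by (auto simp: edge_chains_def)

text \<open>A chain is recovered from its restriction and its new last edge, which meets the
  previous edge and so has at most \<open>D\<close> choices. The condition \<open>Q\<close> at the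
  fixed index \<open>j\<close> survives the restriction.\<close>

lemma card_edge_chains_Suc_right:
  assumes "finite E" and D: "\<And>A. A \<in> E \<Longrightarrow> edge_degree E A \<le> D" and "k \<le> i" "j \<in> {k..i}"
  shows "card {es \<in> edge_chains E k (Suc i). Q (es j)} \<le> card {es \<in> edge_chains E k i. Q (es j)} * D"
proof -
  define S where "S = (SIGMA s:{es \<in> edge_chains E k i. Q (es j)}. {A \<in> E. A \<inter> s i \<noteq> {}})"
  have "card {es \<in> edge_chains E k (Suc i). Q (es j)} \<le> card S"
  proof (rule card_inj_on_le[where f = "\<lambda>es. (restrict es {k..i}, es (Suc i))"])
    show "inj_on (\<lambda>es. (restrict es {k..i}, es (Suc i))) {es \<in> edge_chains E k (Suc i). Q (es j)}"
    proof (rule inj_onI, clarsimp)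
      fix f g assume fg: "f \<in> edge_chains E k (Suc i)" "g \<in> edge_chains E k (Suc i)"
        and eq: "restrict f {k..i} = restrict g {k..i}" "f (Suc i) = g (Suc i)"
      have "f t = g t" if "t \<in> {k..Suc i}" for t
        using that eq(2) fun_cong[OF eq(1), of t] by (cases "t = Suc i") simp_all
      then show "f = g"
        using fg edge_chains_eqI by blast
    qed
    show "(\<lambda>es. (restrict es {k..i}, es (Suc i))) ` {es \<in> edge_chains E k (Suc i). Q (es j)} \<subseteq> S"
      using assms(3,4) by (auto simp: S_def edge_chains_def PiE_iff Int_commute)
    show "finite S" unfolding S_def using assms(1) finite_edge_chains[OF assms(1)] by (intro finite_SigmaI) auto
  qed
  also have "card S = (\<Sum>s\<in>{es \<in> edge_chains E k i. Q (es j)}. card {A \<in> E. A \<inter> s i \<noteq> {}})"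
    unfolding S_def using assms(1) finite_edge_chains[OF assms(1)] by (intro card_SigmaI) auto
  also have "\<dots> \<le> (\<Sum>s\<in>{es \<in> edge_chains E k i. Q (es j)}. D)"
  proof (rule sum_mono)
    fix s assume "s \<in> {es \<in> edge_chains E k i. Q (es j)}"
    then have "s i \<in> E" using assms(3) by (auto simp: edge_chains_def)
    then show "card {A \<in> E. A \<inter> s i \<noteq> {}} \<le> D" using D by (simp add: edge_degree_def)
  qed
  finally show ?thesis by simp
qed

text \<open>The same count with the new edge in front.\<close>

lemma card_edge_chains_Suc_left:
  assumes "finite E" and D: "\<And>A. A \<in> E \<Longrightarrow> edge_degree E A \<le> D" and "k < i" "j \<in> {Suc k..i}"
  shows "card {es \<in> edge_chains E k i. Q (es j)} \<le> card {es \<in> edge_chains E (Suc k) i. Q (es j)} * D"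
proof -
  define S where "S = (SIGMA s:{es \<in> edge_chains E (Suc k) i. Q (es j)}. {A \<in> E. A \<inter> s (Suc k) \<noteq> {}})"
  have "card {es \<in> edge_chains E k i. Q (es j)} \<le> card S"
  proof (rule card_inj_on_le[where f = "\<lambda>es. (restrict es {Suc k..i}, es k)"])
    show "inj_on (\<lambda>es. (restrict es {Suc k..i}, es k)) {es \<in> edge_chains E k i. Q (es j)}"
    proof (rule inj_onI, clarsimp)
      fix f g assume fg: "f \<in> edge_chains E k i" "g \<in> edge_chains E k i"
        and eq: "restrict f {Suc k..i} = restrict g {Suc k..i}" "f k = g k"
      have "f t = g t" if "t \<in> {k..i}" for t
        using that eq(2) fun_cong[OF eq(1), of t] by (cases "t = k") simp_all
      then show "f = g"
        using fg edge_chains_eqI by blast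
    qed
    show "(\<lambda>es. (restrict es {Suc k..i}, es k)) ` {es \<in> edge_chains E k i. Q (es j)} \<subseteq> S"
      using assms(3,4) by (auto simp: S_def edge_chains_def PiE_iff)
    show "finite S" unfolding S_def using assms(1) finite_edge_chains[OF assms(1)] by (intro finite_SigmaI) auto
  qed
  also have "card S = (\<Sum>s\<in>{es \<in> edge_chains E (Suc k) i. Q (es j)}. card {A \<in> E. A \<inter> s (Suc k) \<noteq> {}})"
    unfolding S_def using assms(1) finite_edge_chains[OF assms(1)] by (intro card_SigmaI) auto
  also have "\<dots> \<le> (\<Sum>s\<in>{es \<in> edge_chains E (Suc k) i. Q (es j)}. D)"
  proof (rule sum_mono)
    fix s assume "s \<in> {es \<in> edge_chains E (Suc k) i. Q (es j)}"
    then have "s (Suc k) \<in> E" using assms(3) by (auto simp: edge_chains_def)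
    then show "card {A \<in> E. A \<inter> s (Suc k) \<noteq> {}} \<le> D" using D by (simp add: edge_degree_def)
  qed
  finally show ?thesis by simp
qed

text \<open>At most \<open>D\<close> edges can stand at index \<open>j\<close>, as they meet
  \<open>A\<close>; the chain then grows to the right up to \<open>i\<close> and to the left down to
  \<open>k\<close>, at a factor \<open>D\<close> per edge.\<close>

lemma card_edge_chains_meeting:
  assumes "finite E" and D: "\<And>A. A \<in> E \<Longrightarrow> edge_degree E A \<le> D"
    and A: "A \<in> E" and j: "k \<le> j" "j \<le> i"
  shows "card {es \<in> edge_chains E k i. es j \<inter> A \<noteq> {}} \<le> D ^ Suc (i - k)"
proof -
  have "card {es \<in> edge_chains E j j. es j \<inter> A \<noteq> {}} \<le> card {F \<in> E. F \<inter> A \<noteq> {}}"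
  proof (rule card_inj_on_le[where f = "\<lambda>es. es j"])
    show "inj_on (\<lambda>es. es j) {es \<in> edge_chains E j j. es j \<inter> A \<noteq> {}}"
    proof (rule inj_onI)
      fix f g assume "f \<in> {es \<in> edge_chains E j j. es j \<inter> A \<noteq> {}}"
        "g \<in> {es \<in> edge_chains E j j. es j \<inter> A \<noteq> {}}" "f j = g j"
      then show "f = g" by (intro edge_chains_eqI[of f E j j g]) simp_all
    qed
    show "(\<lambda>es. es j) ` {es \<in> edge_chains E j j. es j \<inter> A \<noteq> {}} \<subseteq> {F \<in> E. F \<inter> A \<noteq> {}}"
      unfolding edge_chains_def by auto
    show "finite {F \<in> E. F \<inter> A \<noteq> {}}" using \<open>finite E\<close> by simp
  qed
  then have base: "card {es \<in> edge_chains E j j. es j \<inter> A \<noteq> {}} \<le> D"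
    using D[OF A] by (simp add: edge_degree_def)
  have right: "card {es \<in> edge_chains E j i. es j \<inter> A \<noteq> {}} \<le> D ^ Suc (i - j)" if "j \<le> i" for i
    using that
  proof (induction i rule: dec_induct)
    case base
    then show ?case using \<open>card {es \<in> edge_chains E j j. es j \<inter> A \<noteq> {}} \<le> D\<close> by simp
  next
    case (step m)
    have "card {es \<in> edge_chains E j (Suc m). es j \<inter> A \<noteq> {}} \<le> card {es \<in> edge_chains E j m. es j \<inter> A \<noteq> {}} * D"
      by (rule card_edge_chains_Suc_right) (use assms step in auto)
    also have "\<dots> \<le> D ^ Suc (m - j) * D" using step by simp
    finally show ?case using step by (simp add: Suc_diff_le mult.commute)
  qed
  show ?thesis using j(1)
  proof (induction k rule: inc_induct)
    case base
    then show ?case using right[OF j(2)] by simp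
  next
    case (step m)
    have "card {es \<in> edge_chains E m i. es j \<inter> A \<noteq> {}} \<le> card {es \<in> edge_chains E (Suc m) i. es j \<inter> A \<noteq> {}} * D"
      by (rule card_edge_chains_Suc_left) (use assms step in auto)
    also have "\<dots> \<le> D ^ Suc (i - Suc m) * D" using step by simp
    also have "\<dots> = D ^ Suc (i - m)"
      using step j by (simp add: Suc_diff_Suc flip: power_Suc2)
    finally show ?case .
  qed
qed

text \<open>The links lie on the edges of the chain, so the ends of the avoided intervals are
  determined by positions there. This makes vertex-disjoint chains independent.\<close>

lemma chain_event_cong:
  assumes "\<And>u. u \<in> (\<Union>j\<in>{k..i}. es j) \<Longrightarrow> \<sigma> u = \<sigma>' u"
  shows "\<sigma> \<in> chain_event B k i es \<longleftrightarrow> \<sigma>' \<in> chain_event B k i es"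
proof -
  have *: "\<sigma>' \<in> chain_event B k i es"
    if eq: "\<And>u. u \<in> (\<Union>j\<in>{k..i}. es j) \<Longrightarrow> \<sigma> u = \<sigma>' u" and mem: "\<sigma> \<in> chain_event B k i es"
    for \<sigma> \<sigma>' :: "'a \<Rightarrow> nat"
  proof -
    obtain vs where vs: "\<And>j. j \<in> {k..<i} \<Longrightarrow> vs j \<in> es j \<inter> es (Suc j) \<and> \<sigma> (vs j) \<in> {j * B<..<Suc j * B}"
      and av: "\<And>j u. j \<in> {k..i} \<Longrightarrow> u \<in> es j \<Longrightarrow>
        \<sigma> u \<notin> {gap B k i (\<sigma> \<circ> vs) (j - 1)<..<gap B k i (\<sigma> \<circ> vs) j}"
      using mem unfolding chain_event_def by blast
    have same: "\<sigma> (vs j) = \<sigma>' (vs j)" if "j \<in> {k..<i}" for j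
      using vs[OF that] that by (intro eq) auto
    then have gap_eq: "gap B k i (\<sigma> \<circ> vs) j = gap B k i (\<sigma>' \<circ> vs) j" for j
      by (simp add: gap_def)
    show ?thesis
      unfolding chain_event_def
    proof (intro CollectI exI[of _ vs] conjI ballI)
      fix j u assume j: "j \<in> {k..i}" "u \<in> es j"
      then have "\<sigma> u = \<sigma>' u" by (intro eq) auto
      then show "\<sigma>' u \<notin> {gap B k i (\<sigma>' \<circ> vs) (j - 1)<..<gap B k i (\<sigma>' \<circ> vs) j}"
        using av[OF j] gap_eq by simp
    qed (use vs same in auto)
  qed
  show ?thesis using *[of \<sigma> \<sigma>'] *[of \<sigma>' \<sigma>] assms by metis
qed

subsection \<open>The probability of a chain\<close>

text \<open>The law of one position. Equal atoms replace a uniform distribution on each block, so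
  that a union bound over the positions of the links takes the place of integration.\<close>

locale chain_weights =
  fixes B r :: nat and a \<tau> :: real and \<rho> :: "nat pmf"
  assumes B: "0 < B"
    and pmf_multiple: "\<And>j. 1 \<le> j \<Longrightarrow> j \<le> r \<Longrightarrow> pmf \<rho> (j * B) = a"
    and pmf_inner: "\<And>j t. 1 \<le> j \<Longrightarrow> j < r \<Longrightarrow> t \<in> {j * B<..<Suc j * B} \<Longrightarrow> pmf \<rho> t = \<tau>"
    and support: "set_pmf \<rho> \<subseteq> {B..r * B}"
begin

abbreviation "\<mu> \<equiv> measure_pmf.prob \<rho>"

abbreviation "hole k i x j \<equiv> {gap B k i x (j - 1)<..<gap B k i x j}"

lemma gap_bounds:
  assumes "x \<in> (\<Pi> j\<in>{k..<i}. {j * B<..<Suc j * B})"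
  shows "j * B \<le> gap B k i x j" "gap B k i x j \<le> Suc j * B"
  using Pi_mem[OF assms, of j] by (auto simp: gap_def)

text \<open>Hence every hole has mass at least \<open>a\<close>, the value of \<open>lam\<close> in
  \<open>one_minus_sum_le_prod\<close>.\<close>

lemma multiple_in_hole:
  assumes "x \<in> (\<Pi> j\<in>{k..<i}. {j * B<..<Suc j * B})" and "1 \<le> k" "j \<in> {k..i}"
  shows "j * B \<in> hole k i x j"
proof -
  obtain m where m: "j = Suc m" using assms(2,3) by (cases j) auto
  have "gap B k i x m < j * B"
    using Pi_mem[OF assms(1), of m] assms(3) m B by (auto simp: gap_def)
  moreover have "j * B < gap B k i x j"
    using Pi_mem[OF assms(1), of j] assms(3) B by (auto simp: gap_def)
  ultimately show ?thesis by (simp add: m)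
qed

lemma disjoint_holes:
  assumes x: "x \<in> (\<Pi> j\<in>{k..<i}. {j * B<..<Suc j * B})"
  shows "disjoint_family_on (hole k i x) {k..i}"
proof -
  have "hole k i x j \<inter> hole k i x m = {}" if "j < m" for j m
  proof -
    have "gap B k i x j \<le> gap B k i x (m - 1)"
    proof (cases "j = m - 1")
      case False
      then have "Suc j \<le> m - 1" using that by simp
      then have "Suc j * B \<le> (m - 1) * B" by (rule mult_le_mono1)
      then show ?thesis
        using gap_bounds[OF x, where j = j] gap_bounds[OF x, where j = "m - 1"] by linarith
    qed simp
    then show ?thesis by auto
  qed
  then show ?thesis
    unfolding disjoint_family_on_def by (metis Int_commute linorder_neqE_nat)
qed

text \<open>The holes are disjoint, so the probability is one minus the sum of the masses for the
  edges through \<open>u\<close>, and \<open>one_minus_sum_le_prod\<close> applies. The products run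
  over all indices so that they can be exchanged with the product over vertices later.\<close>

lemma prob_avoid_holes_le:
  fixes es :: "nat \<Rightarrow> 'a set"
  assumes x: "x \<in> (\<Pi> j\<in>{k..<i}. {j * B<..<Suc j * B})"
    and k: "1 \<le> k" "i \<le> r"
  defines "y \<equiv> \<lambda>j. 1 - \<mu> (hole k i x j)"
  shows "\<mu> {t. \<forall>j\<in>{k..i}. u \<in> es j \<longrightarrow> t \<notin> hole k i x j}
    \<le> (\<Prod>j\<in>{k..i}. if u \<in> es j then y j else 1)
      * (\<Prod>j\<in>{k..<i}. if u \<in> es j \<inter> es (Suc j) then 1 - a\<^sup>2 else 1)"
proof -
  define J where "J = {j \<in> {k..i}. u \<in> es j}"
  have finJ: "finite J" by (simp add: J_def)
  have disj: "disjoint_family_on (hole k i x) J"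
    using disjoint_holes[OF x] by (rule disjoint_family_on_mono[rotated]) (auto simp: J_def)
  have sum: "\<mu> (\<Union>j\<in>J. hole k i x j) = (\<Sum>j\<in>J. \<mu> (hole k i x j))"
    by (rule measure_pmf.finite_measure_finite_Union) (use finJ disj in auto)
  have "{t. \<forall>j\<in>{k..i}. u \<in> es j \<longrightarrow> t \<notin> hole k i x j} = UNIV - (\<Union>j\<in>J. hole k i x j)"
    by (auto simp: J_def)
  then have "\<mu> {t. \<forall>j\<in>{k..i}. u \<in> es j \<longrightarrow> t \<notin> hole k i x j} = 1 - (\<Sum>j\<in>J. \<mu> (hole k i x j))"
    using measure_pmf.prob_compl[of "\<Union>j\<in>J. hole k i x j" \<rho>] sum by simp
  also have "\<dots> \<le> (\<Prod>j\<in>J. 1 - \<mu> (hole k i x j)) * (1 - a\<^sup>2) ^ card {j \<in> J. Suc j \<in> J}"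
  proof (rule one_minus_sum_le_prod[where k = k and m = i])
    \<comment> \<open>A value of \<open>pmf\<close> if \<open>1 \<le> r\<close>; for
      \<open>r = 0\<close> the support would be empty.\<close>
    show "0 \<le> a"
    proof (cases "1 \<le> r")
      case True
      then show ?thesis using pmf_multiple[of 1] pmf_nonneg[of \<rho> "1 * B"] by simp
    next
      case False
      then have "set_pmf \<rho> = {}" using support B by auto
      then show ?thesis using set_pmf_not_empty by metis
    qed
    show "a \<le> \<mu> (hole k i x j)" if "j \<in> J" for j
    proof -
      have j: "j \<in> {k..i}" using that by (simp add: J_def)
      have "a = \<mu> {j * B}"
        using j k pmf_multiple[of j] by (simp add: measure_pmf_single)
      also have "\<dots> \<le> \<mu> (hole k i x j)"
        using multiple_in_hole[OF x k(1) j] by (intro measure_pmf.finite_measure_mono) auto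
      finally show ?thesis .
    qed
    show "(\<Sum>j\<in>J. \<mu> (hole k i x j)) \<le> 1" using sum measure_pmf.prob_le_1[of \<rho>] by metis
  qed (auto simp: J_def)
  also have "(\<Prod>j\<in>J. 1 - \<mu> (hole k i x j)) = (\<Prod>j\<in>{k..i}. if u \<in> es j then y j else 1)"
    unfolding J_def y_def by (rule prod.inter_filter) simp
  also have "{j \<in> J. Suc j \<in> J} = {j \<in> {k..<i}. u \<in> es j \<inter> es (Suc j)}"
    by (auto simp: J_def)
  also have "(1 - a\<^sup>2) ^ card {j \<in> {k..<i}. u \<in> es j \<inter> es (Suc j)}
      = (\<Prod>j\<in>{k..<i}. if u \<in> es j \<inter> es (Suc j) then 1 - a\<^sup>2 else 1)"
    by (subst prod.inter_filter[symmetric]) auto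
  finally show ?thesis .
qed

text \<open>By independence the probability is at most a product over vertices: a link costs
  \<open>\<tau>\<close>, any other vertex the bound of \<open>prob_avoid_holes_le\<close>. Regrouped
  by edges, the exponents count the vertices of an edge, or of two consecutive edges, without the
  \<open>i - k\<close> links.\<close>

lemma prob_fixed_chain_le:
  fixes es :: "nat \<Rightarrow> 'a set"
  assumes V: "finite V" "\<And>j. j \<in> {k..i} \<Longrightarrow> es j \<subseteq> V" "\<And>j. j \<in> {k..i} \<Longrightarrow> card (es j) = n"
    and k: "1 \<le> k" "i \<le> r"
    and vs: "\<And>j. j \<in> {k..<i} \<Longrightarrow> vs j \<in> es j \<inter> es (Suc j)"
    and x: "x \<in> (\<Pi> j\<in>{k..<i}. {j * B<..<Suc j * B})"
    and Z: "(\<Prod>j\<in>{k..i}. 1 - \<mu> (hole k i x j)) \<le> Z"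
    and "0 \<le> a" "a \<le> 1" "0 \<le> \<tau>"
  shows "measure_pmf.prob (Pi_pmf V 0 (\<lambda>_. \<rho>))
      {\<sigma>. (\<forall>j\<in>{k..<i}. \<sigma> (vs j) = x j) \<and> (\<forall>j\<in>{k..i}. \<forall>u\<in>es j. \<sigma> u \<notin> hole k i x j)}
    \<le> \<tau> ^ (i - k) * Z ^ (n - (i - k))
      * (\<Prod>j\<in>{k..<i}. (1 - a\<^sup>2) ^ (card (es j \<inter> es (Suc j)) - (i - k)))"
    (is "measure_pmf.prob ?P ?X \<le> ?R")
proof -
  define q where "q = 1 - a\<^sup>2"
  define c where "c = i - k"
  define y where "y j = 1 - \<mu> (hole k i x j)" for j
  define W where "W = vs ` {k..<i}"
  define S where "S u = {t. (\<forall>j\<in>{k..<i}. u = vs j \<longrightarrow> t = x j) \<and>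
      (\<forall>j\<in>{k..i}. u \<in> es j \<longrightarrow> t \<notin> hole k i x j)}" for u
  have q: "0 \<le> q" "q \<le> 1" using \<open>0 \<le> a\<close> \<open>a \<le> 1\<close> by (auto simp: q_def power_le_one)
  have y: "0 \<le> y j" "y j \<le> 1" for j by (auto simp: y_def)
  have Z0: "0 \<le> Z"
    using Z prod_nonneg[of "{k..i}" y] y by (simp add: y_def)
  have R0: "0 \<le> ?R" using Z0 q \<open>0 \<le> \<tau>\<close> by (auto simp: q_def intro!: mult_nonneg_nonneg prod_nonneg)
  have vsV: "vs j \<in> V" if "j \<in> {k..<i}" for j
    using vs[OF that] V(2)[of j] that by auto
  have "?X \<subseteq> Pi V S" by (auto simp: S_def)
  then have "measure_pmf.prob ?P ?X \<le> measure_pmf.prob ?P (Pi V S)"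
    by (rule measure_pmf.finite_measure_mono) auto
  also have "\<dots> = (\<Prod>u\<in>V. \<mu> (S u))" by (rule measure_Pi_pmf_Pi) fact
  also have "\<dots> \<le> ?R"
  proof (cases "inj_on vs {k..<i}")
    case False
    \<comment> \<open>Different links have positions in different blocks, so a repeated link makes
      the event impossible.\<close>
    then obtain j m where jm: "j \<in> {k..<i}" "m \<in> {k..<i}" "vs j = vs m" "j < m"
      unfolding inj_on_def by (metis linorder_neqE_nat)
    have "x j < Suc j * B" "m * B < x m" using Pi_mem[OF x jm(1)] Pi_mem[OF x jm(2)] by auto
    moreover have "Suc j * B \<le> m * B" using jm(4) by (intro mult_le_mono1) simp
    ultimately have "x j \<noteq> x m" by simp
    moreover have "t = x j \<and> t = x m" if "t \<in> S (vs j)" for t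
      using that jm(1-3) unfolding S_def by blast
    ultimately have "S (vs j) = {}" by blast
    then have "(\<Prod>u\<in>V. \<mu> (S u)) = 0"
      using vsV[OF jm(1)] V(1) by (intro prod_zero) (auto intro!: bexI[of _ "vs j"])
    then show ?thesis using R0 by simp
  next
    case inj: True
    have WV: "W \<subseteq> V" using vsV by (auto simp: W_def)
    have cardW: "card W = c" using inj by (simp add: W_def c_def card_image)
    have finW: "finite W" by (simp add: W_def)
    have "(\<Prod>u\<in>W. \<mu> (S u)) = (\<Prod>j\<in>{k..<i}. \<mu> (S (vs j)))"
      unfolding W_def by (simp add: prod.reindex[OF inj])
    also have "\<dots> \<le> (\<Prod>j\<in>{k..<i}. \<tau>)"
    proof (rule prod_mono, intro conjI)
      fix j assume j: "j \<in> {k..<i}"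
      have "\<mu> (S (vs j)) \<le> \<mu> {x j}"
        using j by (intro measure_pmf.finite_measure_mono) (auto simp: S_def)
      also have "\<dots> = \<tau>" using pmf_inner[of j "x j"] Pi_mem[OF x j] j k by (simp add: measure_pmf_single)
      finally show "\<mu> (S (vs j)) \<le> \<tau>" .
    qed simp
    finally have PW: "(\<Prod>u\<in>W. \<mu> (S u)) \<le> \<tau> ^ c" by (simp add: c_def)
    have PV: "(\<Prod>u\<in>V - W. \<mu> (S u)) \<le> (\<Prod>u\<in>V - W. (\<Prod>j\<in>{k..i}. if u \<in> es j then y j else 1)
      * (\<Prod>j\<in>{k..<i}. if u \<in> es j \<inter> es (Suc j) then q else 1))"
    proof (rule prod_mono, intro conjI)
      fix u assume "u \<in> V - W"
      have "\<mu> (S u) \<le> \<mu> {t. \<forall>j\<in>{k..i}. u \<in> es j \<longrightarrow> t \<notin> hole k i x j}"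
        by (intro measure_pmf.finite_measure_mono) (auto simp: S_def)
      also have "\<dots> \<le> (\<Prod>j\<in>{k..i}. if u \<in> es j then y j else 1)
          * (\<Prod>j\<in>{k..<i}. if u \<in> es j \<inter> es (Suc j) then q else 1)"
        unfolding y_def q_def by (rule prob_avoid_holes_le[OF x k])
      finally show "\<mu> (S u) \<le> (\<Prod>j\<in>{k..i}. if u \<in> es j then y j else 1)
          * (\<Prod>j\<in>{k..<i}. if u \<in> es j \<inter> es (Suc j) then q else 1)" .
    qed simp
    have count: "(\<Prod>u\<in>V - W. if u \<in> A then z else 1) = z ^ card (A - W)" if "A \<subseteq> V" for A and z :: real
    proof -
      have "(\<Prod>u\<in>V - W. if u \<in> A then z else 1) = (\<Prod>u\<in>{u \<in> V - W. u \<in> A}. z)"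
        using V(1) by (subst prod.inter_filter) auto
      also have "{u \<in> V - W. u \<in> A} = A - W" using that by auto
      finally show ?thesis by simp
    qed
    have "(\<Prod>u\<in>V - W. (\<Prod>j\<in>{k..i}. if u \<in> es j then y j else 1)
      * (\<Prod>j\<in>{k..<i}. if u \<in> es j \<inter> es (Suc j) then q else 1))
      = (\<Prod>j\<in>{k..i}. \<Prod>u\<in>V - W. if u \<in> es j then y j else 1)
        * (\<Prod>j\<in>{k..<i}. \<Prod>u\<in>V - W. if u \<in> es j \<inter> es (Suc j) then q else 1)"
      unfolding prod.distrib by (intro arg_cong2[where f = "(*)"] prod.swap)
    also have "\<dots> = (\<Prod>j\<in>{k..i}. y j ^ card (es j - W))
        * (\<Prod>j\<in>{k..<i}. q ^ card (es j \<inter> es (Suc j) - W))"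
    proof (intro arg_cong2[where f = "(*)"] prod.cong refl)
      show "(\<Prod>u\<in>V - W. if u \<in> es j then y j else 1) = y j ^ card (es j - W)" if "j \<in> {k..i}" for j
        using V(2)[OF that] by (rule count)
      show "(\<Prod>u\<in>V - W. if u \<in> es j \<inter> es (Suc j) then q else 1) = q ^ card (es j \<inter> es (Suc j) - W)"
        if "j \<in> {k..<i}" for j
        using V(2)[of j] that by (intro count) auto
    qed
    also have "\<dots> \<le> (\<Prod>j\<in>{k..i}. y j ^ (n - c)) * (\<Prod>j\<in>{k..<i}. q ^ (card (es j \<inter> es (Suc j)) - c))"
    proof (intro mult_mono prod_mono conjI)
      fix j assume j: "j \<in> {k..i}"
      have "n - c \<le> card (es j - W)"
        using diff_card_le_card_Diff[OF finW, of "es j"] V(3)[OF j] cardW by simp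
      then show "y j ^ card (es j - W) \<le> y j ^ (n - c)" using y by (intro power_decreasing) auto
    next
      fix j assume j: "j \<in> {k..<i}"
      have "card (es j \<inter> es (Suc j)) - c \<le> card (es j \<inter> es (Suc j) - W)"
        using diff_card_le_card_Diff[OF finW] cardW by metis
      then show "q ^ card (es j \<inter> es (Suc j) - W) \<le> q ^ (card (es j \<inter> es (Suc j)) - c)"
        using q by (intro power_decreasing) auto
    qed (use y q in \<open>auto intro!: prod_nonneg\<close>)
    also have "(\<Prod>j\<in>{k..i}. y j ^ (n - c)) \<le> Z ^ (n - c)"
      unfolding prod_power_distrib[symmetric]
      using Z y by (intro power_mono prod_nonneg) (auto simp: y_def)
    finally have PV': "(\<Prod>u\<in>V - W. \<mu> (S u))
        \<le> Z ^ (n - c) * (\<Prod>j\<in>{k..<i}. q ^ (card (es j \<inter> es (Suc j)) - c))"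
      using PV q by (simp add: mult_right_mono prod_nonneg)
    have "(\<Prod>u\<in>V. \<mu> (S u)) = (\<Prod>u\<in>W. \<mu> (S u)) * (\<Prod>u\<in>V - W. \<mu> (S u))"
      using prod.subset_diff[OF WV V(1), of "\<lambda>u. \<mu> (S u)"] by (simp add: mult.commute)
    also have "\<dots> \<le> \<tau> ^ c * (Z ^ (n - c) * (\<Prod>j\<in>{k..<i}. q ^ (card (es j \<inter> es (Suc j)) - c)))"
      using PW PV' \<open>0 \<le> \<tau>\<close> by (intro mult_mono) (auto intro!: prod_nonneg)
    finally show ?thesis by (simp add: c_def q_def mult.assoc)
  qed
  finally show ?thesis .
qed

text \<open>Union bound over the links and their positions. The \<open>B - 1\<close> positions per
  link turn \<open>\<tau>\<close> into the mass of a block, so finer atoms do not worsen the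
  bound.\<close>

lemma prob_chain_event_le:
  fixes es :: "nat \<Rightarrow> 'a set"
  assumes V: "finite V" "\<And>j. j \<in> {k..i} \<Longrightarrow> es j \<subseteq> V" "\<And>j. j \<in> {k..i} \<Longrightarrow> card (es j) = n"
    and k: "1 \<le> k" "i \<le> r"
    and Z: "\<And>x. x \<in> (\<Pi> j\<in>{k..<i}. {j * B<..<Suc j * B}) \<Longrightarrow>
      (\<Prod>j\<in>{k..i}. 1 - \<mu> (hole k i x j)) \<le> Z"
    and "0 \<le> a" "a \<le> 1" "0 \<le> \<tau>"
  shows "measure_pmf.prob (Pi_pmf V 0 (\<lambda>_. \<rho>)) (chain_event B k i es)
    \<le> (real (B - 1) * \<tau>) ^ (i - k) * Z ^ (n - (i - k))
      * (\<Prod>j\<in>{k..<i}. real (card (es j \<inter> es (Suc j)))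
           * (1 - a\<^sup>2) ^ (card (es j \<inter> es (Suc j)) - (i - k)))"
proof -
  let ?P = "Pi_pmf V 0 (\<lambda>_. \<rho>)"
  define Vs where "Vs = (\<Pi>\<^sub>E j\<in>{k..<i}. es j \<inter> es (Suc j))"
  define Xs where "Xs = (\<Pi>\<^sub>E j\<in>{k..<i}. {j * B<..<Suc j * B})"
  define Ev where "Ev = (\<lambda>(vs, x). {\<sigma>. (\<forall>j\<in>{k..<i}. \<sigma> (vs j) = x j) \<and>
      (\<forall>j\<in>{k..i}. \<forall>u\<in>es j. \<sigma> u \<notin> hole k i x j)})"
  define R where "R = \<tau> ^ (i - k) * Z ^ (n - (i - k))
      * (\<Prod>j\<in>{k..<i}. (1 - a\<^sup>2) ^ (card (es j \<inter> es (Suc j)) - (i - k)))"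
  have finVs: "finite Vs" unfolding Vs_def
  proof (rule finite_PiE)
    show "finite (es j \<inter> es (Suc j))" if "j \<in> {k..<i}" for j
      using V(1) V(2)[of j] that finite_subset by auto
  qed simp
  have finXs: "finite Xs" unfolding Xs_def by (rule finite_PiE) auto
  have "chain_event B k i es \<subseteq> (\<Union>p\<in>Vs \<times> Xs. Ev p)"
  proof
    fix \<sigma> assume "\<sigma> \<in> chain_event B k i es"
    then obtain vs where vs: "\<And>j. j \<in> {k..<i} \<Longrightarrow> vs j \<in> es j \<inter> es (Suc j) \<and> \<sigma> (vs j) \<in> {j * B<..<Suc j * B}"
      and av: "\<And>j u. j \<in> {k..i} \<Longrightarrow> u \<in> es j \<Longrightarrow> \<sigma> u \<notin> hole k i (\<sigma> \<circ> vs) j"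
      unfolding chain_event_def by blast
    define vs' where "vs' = restrict vs {k..<i}"
    define x where "x = restrict (\<sigma> \<circ> vs) {k..<i}"
    have "gap B k i (\<sigma> \<circ> vs) j = gap B k i x j" for j by (simp add: gap_def x_def)
    then have "\<sigma> \<in> Ev (vs', x)" using av by (simp add: Ev_def vs'_def x_def)
    moreover have "vs' \<in> Vs" "x \<in> Xs"
      using vs by (auto simp: Vs_def Xs_def vs'_def x_def)
    ultimately show "\<sigma> \<in> (\<Union>p\<in>Vs \<times> Xs. Ev p)" by blast
  qed
  then have "measure_pmf.prob ?P (chain_event B k i es) \<le> measure_pmf.prob ?P (\<Union>p\<in>Vs \<times> Xs. Ev p)"
    by (rule measure_pmf.finite_measure_mono) auto
  also have "\<dots> \<le> (\<Sum>p\<in>Vs \<times> Xs. measure_pmf.prob ?P (Ev p))"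
    by (rule measure_pmf.finite_measure_subadditive_finite) (use finVs finXs in auto)
  also have "\<dots> \<le> (\<Sum>p\<in>Vs \<times> Xs. R)"
  proof (rule sum_mono)
    fix p assume p: "p \<in> Vs \<times> Xs"
    obtain vs x where px: "p = (vs, x)" by (cases p)
    have vs: "\<And>j. j \<in> {k..<i} \<Longrightarrow> vs j \<in> es j \<inter> es (Suc j)"
      and x: "x \<in> (\<Pi> j\<in>{k..<i}. {j * B<..<Suc j * B})"
      using p px unfolding Vs_def Xs_def by (auto dest: PiE_mem simp: PiE_def)
    show "measure_pmf.prob ?P (Ev p) \<le> R"
      unfolding px Ev_def R_def prod.case
      by (rule prob_fixed_chain_le[of V k i es n vs x Z, OF V k vs x Z[OF x]]) (use assms in auto)
  qed
  also have "\<dots> = real (card Vs) * real (card Xs) * R"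
    by (simp add: card_cartesian_product)
  also have "card Vs = (\<Prod>j\<in>{k..<i}. card (es j \<inter> es (Suc j)))"
    unfolding Vs_def by (rule card_PiE) simp
  also have "card Xs = (B - 1) ^ (i - k)"
    unfolding Xs_def by (subst card_PiE) (auto simp: algebra_simps)
  finally show ?thesis
    by (simp add: R_def prod.distrib power_mult_distrib mult_ac)
qed

text \<open>The holes and the \<open>i - k\<close> positions of the links cover the interval, and
  each such position has mass \<open>\<tau>\<close>.\<close>

lemma sum_holes_ge:
  assumes x: "x \<in> (\<Pi> j\<in>{k..<i}. {j * B<..<Suc j * B})" and k: "1 \<le> k" "k \<le> i" "i \<le> r"
  shows "\<mu> {(k - 1) * B<..<Suc i * B} \<le> (\<Sum>j\<in>{k..i}. \<mu> (hole k i x j)) + real (i - k) * \<tau>"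
proof -
  define X where "X = (\<Union>j\<in>{k..i}. hole k i x j) \<union> x ` {k..<i}"
  have "{(k - 1) * B<..<Suc i * B} \<subseteq> X"
  proof
    fix t assume t: "t \<in> {(k - 1) * B<..<Suc i * B}"
    \<comment> \<open>The first hole that ends beyond \<open>t\<close>: either \<open>t\<close> lies
      in it, or \<open>t\<close> is the link at which it begins.\<close>
    define j where "j = (LEAST j. k \<le> j \<and> t < gap B k i x j)"
    have i: "k \<le> i \<and> t < gap B k i x i" using t k by (simp add: gap_def)
    have j: "k \<le> j" "t < gap B k i x j" "j \<le> i"
      using LeastI[of "\<lambda>j. k \<le> j \<and> t < gap B k i x j", OF i]
        Least_le[of "\<lambda>j. k \<le> j \<and> t < gap B k i x j", OF i] by (auto simp: j_def)
    show "t \<in> X"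
    proof (cases "j = k")
      case True
      then have "t \<in> hole k i x j" using t j k by (simp add: gap_def)
      then show ?thesis using j by (auto simp: X_def)
    next
      case False
      then have "\<not> (k \<le> j - 1 \<and> t < gap B k i x (j - 1))"
        using j(1) k(1) not_less_Least[of "j - 1" "\<lambda>j. k \<le> j \<and> t < gap B k i x j"] by (auto simp: j_def)
      then have ge: "gap B k i x (j - 1) \<le> t" using False j(1) by auto
      have "gap B k i x (j - 1) = x (j - 1)" using False j by (auto simp: gap_def)
      moreover have "j - 1 \<in> {k..<i}" using False j k by auto
      ultimately show ?thesis using ge j by (cases "t = x (j - 1)") (auto simp: X_def)
    qed
  qed
  then have "\<mu> {(k - 1) * B<..<Suc i * B} \<le> \<mu> X"
    by (rule measure_pmf.finite_measure_mono) auto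
  also have "\<dots> \<le> \<mu> (\<Union>j\<in>{k..i}. hole k i x j) + \<mu> (x ` {k..<i})"
    unfolding X_def by (rule measure_Un_le) auto
  also have "\<mu> (\<Union>j\<in>{k..i}. hole k i x j) \<le> (\<Sum>j\<in>{k..i}. \<mu> (hole k i x j))"
    by (rule measure_pmf.finite_measure_subadditive_finite) auto
  also have "\<mu> (x ` {k..<i}) \<le> (\<Sum>j\<in>{k..<i}. \<mu> {x j})"
    using measure_pmf.finite_measure_subadditive_finite[of "{k..<i}" "\<lambda>j. {x j}" \<rho>]
    by (simp add: UNION_singleton_eq_range)
  also have "\<dots> = (\<Sum>j\<in>{k..<i}. \<tau>)"
  proof (rule sum.cong[OF refl])
    fix j assume "j \<in> {k..<i}"
    then show "\<mu> {x j} = \<tau>" using pmf_inner[of j "x j"] Pi_mem[OF x, of j] k by (simp add: measure_pmf_single)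
  qed
  finally show ?thesis by simp
qed

lemma measure_inner:
  assumes "1 \<le> j" "j < r"
  shows "\<mu> {j * B<..<Suc j * B} = real (B - 1) * \<tau>"
proof -
  have "\<mu> {j * B<..<Suc j * B} = (\<Sum>t\<in>{j * B<..<Suc j * B}. \<tau>)"
    using pmf_inner[OF assms] by (subst measure_measure_pmf_finite) (auto intro!: sum.cong)
  also have "\<dots> = real (B - 1) * \<tau>" by (simp add: algebra_simps)
  finally show ?thesis .
qed

text \<open>Each of the \<open>Suc (i - k)\<close> multiples of \<open>B\<close> inside is paired
  with a neighbouring block: the one before it if \<open>k > 1\<close>, the one after it if
  \<open>k = 1\<close> and \<open>i < r\<close>. A chain through all colours is excluded because it
  has \<open>r\<close> multiples but only \<open>r - 1\<close> blocks.\<close>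

lemma measure_interval_ge:
  assumes k: "1 \<le> k" "k \<le> i" "i \<le> r" and short: "\<not> (k = 1 \<and> i = r)"
  shows "real (Suc (i - k)) * (a + real (B - 1) * \<tau>) \<le> \<mu> {(k - 1) * B<..<Suc i * B}"
proof -
  have single: "\<mu> {j * B} = a" if "1 \<le> j" "j \<le> r" for j
    using pmf_multiple[OF that] by (simp add: measure_pmf_single)
  have Un: "\<mu> (X \<union> Y) = \<mu> X + \<mu> Y" if "X \<inter> Y = {}" for X Y
    by (rule measure_pmf.finite_measure_Union) (use that in auto)
  show ?thesis
  proof (cases "k = 1")
    case False
    have left: "real (Suc i - k) * (a + real (B - 1) * \<tau>) \<le> \<mu> {(k - 1) * B<..i * B}"
      if "k - 1 \<le> i" "i \<le> r" for i
      using that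
    proof (induction i rule: dec_induct)
      case base
      then show ?case using False k by (simp add: measure_nonneg)
    next
      case (step m)
      have "{(k - 1) * B<..Suc m * B} = {(k - 1) * B<..m * B} \<union> ({m * B<..<Suc m * B} \<union> {Suc m * B})"
      proof -
        have "(k - 1) * B \<le> m * B" using step(1) by (rule mult_le_mono1)
        moreover have "m * B < Suc m * B" using B by simp
        moreover have "{p<..s} = {p<..m} \<union> ({m<..<s} \<union> {s})" if "p \<le> m" "m < s" for p m s :: nat
          using that by auto
        ultimately show ?thesis by blast
      qed
      moreover have "\<mu> ({(k - 1) * B<..m * B} \<union> ({m * B<..<Suc m * B} \<union> {Suc m * B}))
          = \<mu> {(k - 1) * B<..m * B} + (\<mu> {m * B<..<Suc m * B} + \<mu> {Suc m * B})"
        using B by (subst Un, force, subst Un) auto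
      moreover have "\<mu> {m * B<..<Suc m * B} = real (B - 1) * \<tau>"
        using step False k by (intro measure_inner) auto
      moreover have "\<mu> {Suc m * B} = a" using step by (intro single) auto
      moreover have "real (Suc (Suc m) - k) = real (Suc m - k) + 1" using step by auto
      ultimately show ?case using step by (simp add: algebra_simps)
    qed
    have "real (Suc i - k) * (a + real (B - 1) * \<tau>) \<le> \<mu> {(k - 1) * B<..i * B}"
      using k by (intro left) auto
    also have "\<dots> \<le> \<mu> {(k - 1) * B<..<Suc i * B}"
      using B by (intro measure_pmf.finite_measure_mono) auto
    finally show ?thesis using k(2) by (simp only: Suc_diff_le)
  next
    case True
    then have "i < r" using short k by auto
    have right: "real m * (a + real (B - 1) * \<tau>) \<le> \<mu> {0<..<Suc m * B}" if "m < r" for m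
      using that
    proof (induction m)
      case (Suc m)
      have "{0<..<Suc (Suc m) * B} = {0<..<Suc m * B} \<union> ({Suc m * B} \<union> {Suc m * B<..<Suc (Suc m) * B})"
        using B by auto
      moreover have "\<mu> ({0<..<Suc m * B} \<union> ({Suc m * B} \<union> {Suc m * B<..<Suc (Suc m) * B}))
          = \<mu> {0<..<Suc m * B} + (\<mu> {Suc m * B} + \<mu> {Suc m * B<..<Suc (Suc m) * B})"
        using B by (subst Un, force, subst Un) auto
      moreover have "\<mu> {Suc m * B<..<Suc (Suc m) * B} = real (B - 1) * \<tau>"
        using Suc by (intro measure_inner) auto
      moreover have "\<mu> {Suc m * B} = a" using Suc by (intro single) auto
      ultimately show ?case using Suc by (simp add: algebra_simps)
    qed simp
    then show ?thesis using right[OF \<open>i < r\<close>] True k by simp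
  qed
qed

lemma measure_interval_full: "\<mu> {0<..<Suc r * B} = 1"
proof -
  have "\<mu> {B..r * B} = 1"
    using support by (simp add: measure_pmf.prob_eq_1 AE_measure_pmf_iff subset_iff)
  moreover have "\<mu> {B..r * B} \<le> \<mu> {0<..<Suc r * B}"
    using B by (intro measure_pmf.finite_measure_mono) auto
  ultimately show ?thesis using measure_pmf.prob_le_1[of \<rho>] by (metis order_antisym)
qed

end

subsection \<open>Choice of the parameters\<close>

lemma exists_chain_weights:
  assumes "0 < B" "1 \<le> r" "0 \<le> a" "0 \<le> \<tau>"
    and total: "real r * a + real (r - 1) * (real (B - 1) * \<tau>) = 1"
  shows "\<exists>\<rho>. chain_weights B r a \<tau> \<rho>"
proof -
  define w where "w t = (if t \<in> {B..r * B} then if B dvd t then a else \<tau> else 0)" for t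
  have inner: "\<not> B dvd t" if "t \<in> {j * B<..<Suc j * B}" for t j
  proof
    assume "B dvd t"
    then obtain m where "t = m * B" by (metis dvd_div_mult_self)
    then have "j * B < m * B" "m * B < Suc j * B" using that by auto
    then have "j < m" "m < Suc j" by (simp_all only: mult_less_cancel2)
    then show False by simp
  qed
  have "(\<Sum>t\<in>{B..m * B}. if B dvd t then a else \<tau>) = real m * a + real (m - 1) * (real (B - 1) * \<tau>)"
    if "1 \<le> m" for m
    using that
  proof (induction m rule: dec_induct)
    case base
    then show ?case by simp
  next
    case (step m)
    have "B \<le> m * B" using step(1) by (cases m) auto
    moreover have "m * B < Suc m * B" using \<open>0 < B\<close> by simp
    moreover have "{p..s} = {p..m} \<union> ({m<..<s} \<union> {s})" if "p \<le> m" "m < s" for p m s :: nat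
      using that by auto
    ultimately have split: "{B..Suc m * B} = {B..m * B} \<union> ({m * B<..<Suc m * B} \<union> {Suc m * B})" by blast
    have "(\<Sum>t\<in>{B..Suc m * B}. if B dvd t then a else \<tau>)
      = (\<Sum>t\<in>{B..m * B}. if B dvd t then a else \<tau>)
        + ((\<Sum>t\<in>{m * B<..<Suc m * B}. if B dvd t then a else \<tau>) + a)"
      unfolding split using \<open>m * B < Suc m * B\<close>
      by (subst sum.union_disjoint, simp, simp, force, subst sum.union_disjoint) auto
    also have "(\<Sum>t\<in>{m * B<..<Suc m * B}. if B dvd t then a else \<tau>) = (\<Sum>t\<in>{m * B<..<Suc m * B}. \<tau>)"
      using inner by (intro sum.cong refl) auto
    also have "\<dots> = real (B - 1) * \<tau>" by (simp add: algebra_simps)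
    finally show ?case using step by (simp add: algebra_simps of_nat_diff)
  qed
  then have "sum w {B..r * B} = 1"
    using total \<open>1 \<le> r\<close> by (simp add: w_def)
  moreover have w0: "0 \<le> w t" for t using assms by (simp add: w_def)
  moreover have "(\<integral>\<^sup>+t. ennreal (w t) \<partial>count_space UNIV) = (\<Sum>t\<in>{B..r * B}. ennreal (w t))"
    by (rule nn_integral_count_space') (auto simp: w_def)
  ultimately have "(\<integral>\<^sup>+t. ennreal (w t) \<partial>count_space UNIV) = 1"
    by (simp add: sum_ennreal)
  then have pmf: "pmf (embed_pmf w) t = w t" for t
    by (intro pmf_embed_pmf w0)
  have "chain_weights B r a \<tau> (embed_pmf w)"
  proof
    show "pmf (embed_pmf w) (j * B) = a" if "1 \<le> j" "j \<le> r" for j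
      using that mult_le_mono1[OF that(1), of B] by (simp add: pmf w_def)
    show "pmf (embed_pmf w) t = \<tau>" if "1 \<le> j" "j < r" "t \<in> {j * B<..<Suc j * B}" for j t
    proof -
      have "1 * B \<le> j * B" using that(1) by (rule mult_le_mono1)
      moreover have "Suc j * B \<le> r * B" using that(2) by (intro mult_le_mono1) simp
      moreover have "j * B < t" "t < Suc j * B" using that(3) by auto
      ultimately have "t \<in> {B..r * B}" unfolding atLeastAtMost_iff by linarith
      then show ?thesis using inner[OF that(3)] by (simp add: pmf w_def)
    qed
    show "set_pmf (embed_pmf w) \<subseteq> {B..r * B}"
      by (auto simp: set_pmf_eq pmf w_def split: if_splits)
  qed fact
  then show ?thesis by blast
qed

section \<open>Elementary estimates for links and products\<close>

lemma mult_power_le: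
  fixes q :: real
  assumes "0 \<le> q" "q < 1"
  shows "real h * q ^ h \<le> 1 / (1 - q)"
proof -
  have "real h * q ^ h = (\<Sum>j<h. q ^ h)" by simp
  \<comment> \<open>Each of the first \<open>h\<close> terms of the geometric series is at least
    \<open>q ^ h\<close>.\<close>
  also have "\<dots> \<le> (\<Sum>j<h. q ^ j)"
    using assms by (intro sum_mono power_decreasing) auto
  also have "\<dots> = (1 - q ^ h) / (1 - q)" using assms by (simp add: sum_gp_strict)
  also have "\<dots> \<le> 1 / (1 - q)" using assms by (intro divide_right_mono) auto
  finally show ?thesis .
qed

text \<open>Apply \<open>1 + z \<le> exp z\<close> with \<open>z = y j / b - 1\<close>. This stands
  in for the inequality of the means and keeps the deviation of the sum from
  \<open>card J * b\<close> in an exponent.\<close>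

lemma prod_le_power_exp:
  fixes y :: "'b \<Rightarrow> real"
  assumes "0 < b" "\<And>j. j \<in> J \<Longrightarrow> 0 \<le> y j"
  shows "prod y J \<le> b ^ card J * exp ((sum y J - real (card J) * b) / b)"
proof -
  have "prod y J \<le> (\<Prod>j\<in>J. b * exp (y j / b - 1))"
  proof (rule prod_mono, intro conjI)
    fix j assume "j \<in> J"
    then show "0 \<le> y j" by (rule assms)
    have "b * (1 + (y j / b - 1)) \<le> b * exp (y j / b - 1)"
      using \<open>0 < b\<close> by (intro mult_left_mono exp_ge_add_one_self) auto
    then show "y j \<le> b * exp (y j / b - 1)" using \<open>0 < b\<close> by simp
  qed
  also have "\<dots> = b ^ card J * exp (\<Sum>j\<in>J. y j / b - 1)"
    by (cases "finite J") (simp_all add: prod.distrib exp_sum)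
  also have "(\<Sum>j\<in>J. y j / b - 1) = (sum y J - real (card J) * b) / b"
    using \<open>0 < b\<close> by (simp add: sum_subtractf sum_divide_distrib diff_divide_distrib)
  finally show ?thesis .
qed


text \<open>At most \<open>exp 1\<close>, by \<open>1 + z \<le> exp z\<close>. This is the cost of
  giving up \<open>c\<close> vertices per edge to links.\<close>

lemma power_ratio_le_3:
  assumes "2 \<le> r" "c < r"
  shows "(real r / (real r - 1)) ^ c \<le> 3"
proof -
  have r: "0 < real r - 1" using assms by simp
  have "(real r / (real r - 1)) ^ c \<le> (1 + 1 / (real r - 1)) ^ (r - 1)"
    using assms r by (intro order_trans[OF power_increasing[of c "r - 1"]] power_mono)
      (auto simp: field_simps)
  also have "\<dots> \<le> exp (1 / (real r - 1)) ^ (r - 1)"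
    using r by (intro power_mono exp_ge_add_one_self) auto
  also have "\<dots> = exp 1"
    using assms r by (simp add: exp_of_nat_mult[symmetric] of_nat_diff)
  also have "\<dots> \<le> 3" by (rule exp_le)
  finally show ?thesis .
qed

text \<open>This is \<open>mult_power_le\<close> up to the missing power \<open>c\<close>, which
  costs at most \<open>4 / 3\<close> by Bernoulli's inequality, as
  \<open>c * a\<^sup>2 \<le> (r - 1) / r\<^sup>2 \<le> 1 / 4\<close>.\<close>

lemma mult_power_diff_le:
  fixes a :: real
  assumes "2 \<le> r" "c < r" "0 < a" "a \<le> 1 / real r"
  shows "real h * (1 - a\<^sup>2) ^ (h - c) \<le> 4 / (3 * a\<^sup>2)"
proof -
  define q where "q = 1 - a\<^sup>2"
  have a2: "a\<^sup>2 \<le> (1 / real r)\<^sup>2" using assms by (intro power_mono) auto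
  have r2: "2 \<le> real r" using assms by simp
  have "a < 1" using assms(4) r2 by (smt (verit) divide_less_eq_1_pos)
  then have q: "0 < q" "q < 1" using \<open>0 < a\<close> by (auto simp: q_def power_less_one_iff abs_square_less_1)
  have "real c * a\<^sup>2 \<le> (real r - 1) * (1 / real r)\<^sup>2"
    using assms a2 by (intro mult_mono) auto
  also have "\<dots> \<le> 1 / 4"
  proof -
    have "0 \<le> (real r - 2)\<^sup>2" by simp
    then have "4 * (real r - 1) \<le> (real r)\<^sup>2" by (simp add: power2_eq_square algebra_simps)
    then show ?thesis using r2 by (simp add: field_simps power2_eq_square)
  qed
  finally have "3 / 4 \<le> 1 - real c * a\<^sup>2" by simp
  also have "\<dots> \<le> q ^ c"
    using Bernoulli_inequality[of "- a\<^sup>2" c] q by (simp add: q_def)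
  finally have qc: "3 / 4 \<le> q ^ c" .
  have "q ^ (h - c) * q ^ c \<le> q ^ h"
    unfolding power_add[symmetric] using q by (intro power_decreasing) auto
  then have "real h * (q ^ (h - c) * q ^ c) \<le> real h * q ^ h" by (intro mult_left_mono) auto
  also have "\<dots> \<le> 1 / (1 - q)" using q by (intro mult_power_le) auto
  finally have "real h * q ^ (h - c) * q ^ c \<le> 1 / a\<^sup>2" by (simp add: q_def mult.assoc)
  moreover have "real h * q ^ (h - c) * (3 / 4) \<le> real h * q ^ (h - c) * q ^ c"
    using qc q by (intro mult_left_mono) auto
  ultimately have "real h * q ^ (h - c) * (3 / 4) \<le> 1 / a\<^sup>2" by linarith
  then show ?thesis by (simp add: q_def field_simps)
qed

locale chain_parameters =
  fixes n r :: nat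
  assumes n3: "3 \<le> n" and r2: "2 \<le> r" and small: "100 * real r ^ 3 < real n / ln (real n)"
begin

text \<open>The blocks \<open>\<delta>\<^sub>1, \<dots>, \<delta>\<^sub>r\<^sub>-\<^sub>1\<close> have total mass \<open>p\<close>, chosen such that \<open>(1 - p / (r - 1)\<^sup>2)\<^sup>n\<close> is about
  \<open>n powr - \<beta>\<close>: this is what the chains that do not run through all colours gain at their ends.
  Each \<open>\<delta>\<^sub>i\<close> consists of \<open>100 n\<close> atoms of mass \<open>\<tau>\<close>, so that discretisation costs only a constant
  factor per edge.\<close>

definition X :: real where "X = real n / ln (real n)"
definition \<beta> :: real where "\<beta> = (real r - 1) / real r"
definition p :: real where "p = (real r - 1) ^ 3 / (real r * X)"
definition a :: real where "a = (1 - p) / real r"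
definition B :: nat where "B = 100 * n + 1"
definition \<tau> :: real where "\<tau> = p / ((real r - 1) * (100 * real n))"
text \<open>The gain in the exponent per edge and vertex. The interval of a chain through all
  colours has mass 1, just \<open>1 / r\<close> per edge, so nothing is gained there.\<close>

definition \<theta> :: "nat \<Rightarrow> nat \<Rightarrow> real" where
  "\<theta> k i = (if k = 1 \<and> i = r then 0 else p / (real r - 1)\<^sup>2)"

lemma r_gt: "2 \<le> real r" "0 < real r" "0 < real r - 1"
  using r2 by auto

lemma ln_n: "1 < ln (real n)"
proof -
  have "exp (1::real) < 3" using e_less_272 by linarith
  then have "exp 1 < real n" using n3 by linarith
  then show ?thesis by (smt (verit) exp_ln ln_less_cancel_iff exp_gt_zero ln_exp)
qed

lemma X_gt: "100 * real r ^ 3 < X" "800 < X" "X \<le> real n"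
proof -
  show *: "100 * real r ^ 3 < X" using small by (simp add: X_def)
  have "2 ^ 3 \<le> real r ^ 3" using r_gt by (intro power_mono) auto
  then show "800 < X" using * by simp
  show "X \<le> real n" using ln_n n3 by (simp add: X_def divide_le_eq)
qed

lemma \<beta>: "0 < \<beta>" "\<beta> < 1"
  using r_gt by (auto simp: \<beta>_def)

lemma p_pos: "0 < p"
  using r_gt X_gt by (simp add: p_def)

lemma p_le: "p \<le> 1 / (100 * real r)"
proof -
  have "(real r - 1) ^ 3 \<le> real r ^ 3" using r_gt by (intro power_mono) auto
  then have "100 * (real r - 1) ^ 3 \<le> X" using X_gt by linarith
  then show ?thesis using r_gt X_gt by (simp add: p_def field_simps)
qed

lemma p_le': "p \<le> 1 / 200"
proof -
  have "1 / (100 * real r) \<le> 1 / 200" using r_gt by (intro divide_left_mono) auto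
  then show ?thesis using p_le by linarith
qed

lemma a: "0 < a" "a \<le> 1 / real r" "a \<le> 1"
proof -
  show "0 < a" using p_le' r_gt by (simp add: a_def)
  show *: "a \<le> 1 / real r" using p_pos r_gt by (simp add: a_def divide_right_mono)
  show "a \<le> 1" using r_gt by (intro order_trans[OF *]) auto
qed

lemma \<tau>: "0 < \<tau>" "\<tau> * real n \<le> 1 / 100" "real (B - 1) * \<tau> = p / (real r - 1)"
proof -
  show "0 < \<tau>" using p_pos r_gt n3 by (simp add: \<tau>_def)
  have "p / (real r - 1) \<le> 1" using p_le' r_gt by (simp add: divide_le_eq)
  then have "p / (real r - 1) / 100 \<le> 1 / 100" by (rule divide_right_mono) simp
  moreover have "\<tau> * real n = p / (real r - 1) / 100"
    unfolding \<tau>_def using n3 by (simp add: divide_simps)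
  ultimately show "\<tau> * real n \<le> 1 / 100" by (simp only:)
  show "real (B - 1) * \<tau> = p / (real r - 1)" using n3 r_gt by (simp add: \<tau>_def B_def)
qed

lemma exists_positions: "\<exists>\<rho>. chain_weights B r a \<tau> \<rho>"
proof (rule exists_chain_weights)
  show "real r * a + real (r - 1) * (real (B - 1) * \<tau>) = 1"
    unfolding \<tau>(3) using r_gt r2 by (simp add: a_def of_nat_diff)
qed (use a \<tau> r2 in \<open>auto simp: B_def\<close>)

text \<open>The purpose of the choice of \<open>p\<close>: over \<open>n\<close> vertices the gain
  amounts to a factor \<open>n powr - \<beta>\<close>.\<close>

lemma \<theta>_short: "p / (real r - 1)\<^sup>2 = \<beta> * ln (real n) / real n"
proof -
  have "s ^ 3 / (R * Y) / s\<^sup>2 = s / R / Y" if "0 < s" for s R Y :: real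
    using that by (simp add: power2_eq_square power3_eq_cube)
  then have "p / (real r - 1)\<^sup>2 = \<beta> / X"
    unfolding p_def \<beta>_def using r_gt by blast
  then show ?thesis by (simp add: X_def)
qed

text \<open>The mass of the interval and \<open>sum_holes_ge\<close> show that the complements
  average at most \<open>\<beta> * (1 + \<tau> - \<theta> k i)\<close>, where \<open>\<beta>\<close>
  is the probability of avoiding a set of mass \<open>1 / r\<close>; then
  \<open>prod_le_power_exp\<close> applies.\<close>

lemma prod_holes_le:
  assumes "chain_weights B r a \<tau> \<rho>" and k: "1 \<le> k" "k \<le> i" "i \<le> r"
    and x: "x \<in> (\<Pi> j\<in>{k..<i}. {j * B<..<Suc j * B})"
  shows "(\<Prod>j\<in>{k..i}. 1 - measure_pmf.prob \<rho> {gap B k i x (j - 1)<..<gap B k i x j})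
    \<le> (\<beta> * exp (\<tau> - \<theta> k i)) ^ Suc (i - k)"
proof -
  interpret chain_weights B r a \<tau> \<rho> by fact
  define t where "t = Suc (i - k)"
  define L where "L = (\<Sum>j\<in>{k..i}. \<mu> (hole k i x j))"
  have t: "card {k..i} = t" "t \<le> r" using k by (auto simp: t_def)
  have L: "\<mu> {(k - 1) * B<..<Suc i * B} \<le> L + real (i - k) * \<tau>"
    unfolding L_def by (rule sum_holes_ge[OF x k])
  have mass: "real t / real r + real t * \<beta> * \<theta> k i \<le> \<mu> {(k - 1) * B<..<Suc i * B}"
  proof (cases "k = 1 \<and> i = r")
    \<comment> \<open>Here \<open>t = r\<close> and \<open>\<theta>\<close> vanishes, so both sides
      are 1.\<close>
    case True
    then show ?thesis using measure_interval_full r_gt r2 by (simp add: \<theta>_def t_def)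
  next
    case False
    have "real t * (a + real (B - 1) * \<tau>) \<le> \<mu> {(k - 1) * B<..<Suc i * B}"
      unfolding t_def by (rule measure_interval_ge[OF k False])
    moreover have "a + real (B - 1) * \<tau> = 1 / real r + \<beta> * \<theta> k i"
    proof -
      have "\<theta> k i = p / (real r - 1)\<^sup>2" unfolding \<theta>_def by (rule if_not_P[OF False])
      moreover have "(1 - p) / real r + p / (real r - 1) = 1 / real r + \<beta> * (p / (real r - 1)\<^sup>2)"
      proof -
        have "(1 - z) / (s + 1) + z / s = 1 / (s + 1) + s / (s + 1) * (z / s\<^sup>2)" if "0 < s" for s z :: real
          using that by (simp add: divide_simps power2_eq_square) (simp add: algebra_simps)
        from this[of "real r - 1" p] show ?thesis using r_gt by (simp add: \<beta>_def)
      qed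
      ultimately show ?thesis unfolding \<tau>(3) a_def by simp
    qed
    ultimately have "real t * (1 / real r + \<beta> * \<theta> k i) \<le> \<mu> {(k - 1) * B<..<Suc i * B}" by (simp only:)
    then show ?thesis by (simp add: distrib_left mult.assoc)
  qed
  \<comment> \<open>There is one link fewer than edges, and \<open>t \<le> r\<close> gives
    \<open>t - 1 \<le> t * \<beta>\<close>.\<close>
  have "real (i - k) * \<tau> \<le> real t * \<beta> * \<tau>"
  proof (intro mult_right_mono)
    have "real t * (1 / real r) \<le> 1" using t r_gt by (simp add: divide_le_eq)
    then show "real (i - k) \<le> real t * \<beta>"
      using r_gt by (simp add: \<beta>_def t_def diff_divide_distrib algebra_simps)
  qed (use \<tau> in simp)
  then have "real t / real r - L \<le> real t * \<beta> * (\<tau> - \<theta> k i)"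
    using L mass by (simp add: algebra_simps)
  then have "(real t / real r - L) / \<beta> \<le> real t * (\<tau> - \<theta> k i)"
    using \<beta> by (simp add: divide_le_eq mult_ac)
  moreover have "(\<Sum>j\<in>{k..i}. 1 - \<mu> (hole k i x j)) - real (card {k..i}) * \<beta> = real t / real r - L"
    unfolding t(1) using r_gt t(1)
    by (simp add: sum_subtractf L_def \<beta>_def diff_divide_distrib right_diff_distrib del: card_atLeastAtMost)
  ultimately have e: "((\<Sum>j\<in>{k..i}. 1 - \<mu> (hole k i x j)) - real (card {k..i}) * \<beta>) / \<beta> \<le> real t * (\<tau> - \<theta> k i)"
    by simp
  have "(\<Prod>j\<in>{k..i}. 1 - \<mu> (hole k i x j))
    \<le> \<beta> ^ card {k..i} * exp (((\<Sum>j\<in>{k..i}. 1 - \<mu> (hole k i x j)) - real (card {k..i}) * \<beta>) / \<beta>)"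
    by (rule prod_le_power_exp) (use \<beta> in auto)
  also have "\<dots> \<le> \<beta> ^ t * exp (real t * (\<tau> - \<theta> k i))"
    unfolding t(1) using e[unfolded t(1)] \<beta> by (intro mult_left_mono) auto
  also have "\<dots> = (\<beta> * exp (\<tau> - \<theta> k i)) ^ t"
    by (simp add: power_mult_distrib exp_of_nat_mult)
  finally show ?thesis by (simp only: t_def)
qed

text \<open>The price of one link: the mass of its block times the bound of
  \<open>mult_power_diff_le\<close>. The \<open>(1 - p)\<^sup>2\<close> hidden in
  \<open>a\<^sup>2\<close> is absorbed, since \<open>r * p \<le> 1\<close> gives
  \<open>r - 1 \<le> r * (1 - p)\<close>.\<close>

lemma link_factor_le: "real (B - 1) * \<tau> * (4 / (3 * a\<^sup>2)) \<le> 4 / 3 * real r ^ 3 / X"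
proof -
  have "real r * p \<le> 1 / 100" using p_le r_gt by (simp add: field_simps)
  then have "real r - 1 \<le> real r * (1 - p)" by (simp add: algebra_simps)
  then have sq: "(real r - 1)\<^sup>2 \<le> (real r * (1 - p))\<^sup>2" using r_gt by (intro power_mono) auto
  have p1: "0 < 1 - p" using p_le' by simp
  have "real (B - 1) * \<tau> * (4 / (3 * a\<^sup>2)) = 4 / 3 * (real r * (real r - 1)\<^sup>2 / (1 - p)\<^sup>2) / X"
  proof -
    have "s ^ 3 / (R * Y) / s * (4 / (3 * (z / R)\<^sup>2)) = 4 / 3 * (R * s\<^sup>2 / z\<^sup>2) / Y"
      if "0 < s" "0 < R" "0 < z" "0 < Y" for s R Y z :: real
      using that by (simp add: field_simps power2_eq_square power3_eq_cube)
    from this[of "real r - 1" "real r" "1 - p" X] show ?thesis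
      unfolding \<tau>(3) a_def using r_gt X_gt p1 by (simp flip: p_def)
  qed
  also have "\<dots> \<le> 4 / 3 * real r ^ 3 / X"
  proof (intro divide_right_mono mult_left_mono)
    have "real r * (real r - 1)\<^sup>2 \<le> real r * (real r * (1 - p))\<^sup>2"
      using sq by (intro mult_left_mono) auto
    then show "real r * (real r - 1)\<^sup>2 / (1 - p)\<^sup>2 \<le> real r ^ 3"
      using p1 by (simp add: divide_le_eq power_mult_distrib power2_eq_square power3_eq_cube mult_ac)
  qed (use X_gt in auto)
  finally show ?thesis .
qed

text \<open>\<open>(r / (r - 1)) ^ n\<close> cancels \<open>\<beta> ^ (n - c)\<close> up to a factor
  3; discretisation and the vertices lost to links in the gain cost at most 1.02 each, and
  \<open>3 * 1.02\<^sup>2 / 40 < 1 / 12\<close>. The gain removes \<open>X powr \<beta>\<close>, as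
  \<open>X \<le> n\<close>, except for a chain through all colours.\<close>

lemma edge_factor_le:
  assumes D: "D \<le> 1 / (40 * real r ^ 3) * X powr \<beta> * (real r / (real r - 1)) ^ n" and c: "c < r"
  shows "D * (\<beta> * exp (\<tau> - \<theta> k i)) ^ (n - c)
    \<le> 1 / (12 * real r ^ 3) * (if k = 1 \<and> i = r then X powr \<beta> else 1)"
proof -
  have "real r \<le> real r ^ 3" using r_gt by (intro self_le_power) auto
  moreover have "real c \<le> real r" using c by simp
  ultimately have "100 * real c \<le> X" "real c \<le> real n"
    using X_gt by linarith+
  then have cX: "100 * real c \<le> X" "c \<le> n" by simp_all
  have split: "(real r / (real r - 1)) ^ n * \<beta> ^ (n - c) = (real r / (real r - 1)) ^ c"
  proof -
    have "(real r / (real r - 1)) * \<beta> = 1" using r_gt by (simp add: \<beta>_def)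
    then have "(real r / (real r - 1)) ^ (n - c) * \<beta> ^ (n - c) = 1"
      by (metis power_mult_distrib power_one)
    moreover have "(real r / (real r - 1)) ^ n = (real r / (real r - 1)) ^ c * (real r / (real r - 1)) ^ (n - c)"
      using cX by (simp flip: power_add)
    ultimately show ?thesis by simp
  qed
  have e1: "exp (1 / 100 :: real) \<le> 102 / 100"
    using exp_bound[of "1 / 100 :: real"] by (simp add: power2_eq_square)
  have e2: "exp (\<tau> * real (n - c)) \<le> 102 / 100"
  proof -
    have "\<tau> * real (n - c) \<le> \<tau> * real n" using \<tau> by (intro mult_left_mono) auto
    then have "exp (\<tau> * real (n - c)) \<le> exp (1 / 100)" using \<tau>(2) by simp
    then show ?thesis using e1 by linarith
  qed
  have e3: "X powr \<beta> * exp (- (\<theta> k i * real (n - c))) \<le> 102 / 100 * (if k = 1 \<and> i = r then X powr \<beta> else 1)"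
  proof (cases "k = 1 \<and> i = r")
    case True
    then show ?thesis by (simp add: \<theta>_def)
  next
    case False
    then have th: "\<theta> k i = \<beta> * ln (real n) / real n"
      unfolding \<theta>_def using \<theta>_short by auto
    \<comment> \<open>Giving up \<open>c\<close> vertices loses only \<open>\<beta> * c / X\<close>,
      which is at most \<open>1 / 100\<close>.\<close>
    have "\<theta> k i * real (n - c) = \<beta> * ln (real n) - \<beta> * (real c / X)"
      unfolding th using cX n3 by (simp add: X_def of_nat_diff field_simps)
    moreover have "\<beta> * (real c / X) \<le> 1 * (1 / 100)"
      using \<beta> cX X_gt by (intro mult_mono) (auto simp: field_simps)
    ultimately have "exp (- (\<theta> k i * real (n - c))) \<le> exp (1 / 100 - \<beta> * ln (real n))" by simp
    also have "\<dots> = exp (1 / 100) * real n powr (- \<beta>)"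
      using n3 by (simp add: powr_def flip: exp_add)
    finally have "X powr \<beta> * exp (- (\<theta> k i * real (n - c))) \<le> X powr \<beta> * (exp (1 / 100) * real n powr (- \<beta>))"
      by (intro mult_left_mono) auto
    also have "\<dots> \<le> real n powr \<beta> * (exp (1 / 100) * real n powr (- \<beta>))"
      using X_gt \<beta> by (intro mult_right_mono powr_mono2) auto
    also have "\<dots> = exp (1 / 100)" using n3 by (simp add: powr_minus)
    finally show ?thesis using e1 unfolding if_not_P[OF False] by linarith
  qed
  define Y where "Y = (if k = 1 \<and> i = r then X powr \<beta> else 1)"
  have "0 \<le> Y" by (simp add: Y_def)
  have "(\<beta> * exp (\<tau> - \<theta> k i)) ^ (n - c)
      = \<beta> ^ (n - c) * exp (\<tau> * real (n - c)) * exp (- (\<theta> k i * real (n - c)))"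
    by (simp add: power_mult_distrib exp_of_nat_mult[symmetric] exp_add[symmetric] algebra_simps)
  then have "D * (\<beta> * exp (\<tau> - \<theta> k i)) ^ (n - c) \<le> (1 / (40 * real r ^ 3) * X powr \<beta> * (real r / (real r - 1)) ^ n)
      * (\<beta> ^ (n - c) * exp (\<tau> * real (n - c)) * exp (- (\<theta> k i * real (n - c))))"
    using D \<beta> by (simp only:) (intro mult_right_mono, auto)
  also have "\<dots> = 1 / (40 * real r ^ 3) * (((real r / (real r - 1)) ^ n * \<beta> ^ (n - c)) * exp (\<tau> * real (n - c))
      * (X powr \<beta> * exp (- (\<theta> k i * real (n - c)))))"
    by (simp add: mult_ac)
  also have "\<dots> \<le> 1 / (40 * real r ^ 3) * (3 * (102 / 100) * (102 / 100 * Y))"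
    unfolding split Y_def
    by (intro mult_left_mono mult_mono[OF mult_mono[OF power_ratio_le_3[OF r2 c] e2] e3])
      (use r_gt in auto)
  also have "\<dots> \<le> 1 / (12 * real r ^ 3) * Y"
    using \<open>0 \<le> Y\<close> r_gt by (simp add: field_simps)
  finally show ?thesis by (simp only: Y_def)
qed


text \<open>Each of the \<open>c\<close> link factors combines with an edge factor to
  \<open>1 / 9\<close>, up to powers of \<open>X\<close>; the one remaining edge factor supplies
  \<open>1 / r ^ 3\<close>.\<close>

lemma degree_power_chain_prob_le:
  fixes es :: "nat \<Rightarrow> 'a set"
  assumes "chain_weights B r a \<tau> \<rho>" and V: "finite V" "E \<subseteq> Pow V" "\<And>e. e \<in> E \<Longrightarrow> card e = n"
    and es: "es \<in> edge_chains E k i" and k: "1 \<le> k" "k \<le> i" "i \<le> r"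
    and D: "0 \<le> D" "D \<le> 1 / (40 * real r ^ 3) * X powr \<beta> * (real r / (real r - 1)) ^ n"
  shows "D ^ Suc (i - k) * measure_pmf.prob (Pi_pmf V 0 (\<lambda>_. \<rho>)) (chain_event B k i es)
    \<le> 1 / real r ^ 3 * (1 / 9) ^ Suc (i - k)"
proof -
  interpret chain_weights B r a \<tau> \<rho> by fact
  define c where "c = i - k"
  define z where "z = \<beta> * exp (\<tau> - \<theta> k i)"
  define Y where "Y = (if k = 1 \<and> i = r then X powr \<beta> else 1)"
  define h where "h j = card (es j \<inter> es (Suc j))" for j
  have c: "c < r" using k by (auto simp: c_def)
  have z0: "0 \<le> z" using \<beta> by (simp add: z_def)
  have esE: "es j \<in> E" if "j \<in> {k..i}" for j using es that by (auto simp: edge_chains_def)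
  have a0: "0 < 4 / (3 * a\<^sup>2)" using a(1) by simp
  have q0: "0 \<le> 1 - a\<^sup>2" using a by (simp add: power_le_one)
  have m0: "0 \<le> real (B - 1) * \<tau>" using \<tau>(1) by simp
  have "measure_pmf.prob (Pi_pmf V 0 (\<lambda>_. \<rho>)) (chain_event B k i es)
      \<le> (real (B - 1) * \<tau>) ^ c * (z ^ Suc c) ^ (n - c) * (\<Prod>j\<in>{k..<i}. real (h j) * (1 - a\<^sup>2) ^ (h j - c))"
    unfolding c_def h_def z_def
  proof (rule prob_chain_event_le[of V k i es n])
    show "es j \<subseteq> V" "card (es j) = n" if "j \<in> {k..i}" for j using esE[OF that] V by auto
    show "(\<Prod>j\<in>{k..i}. 1 - \<mu> (hole k i x j)) \<le> (\<beta> * exp (\<tau> - \<theta> k i)) ^ Suc (i - k)"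
      if "x \<in> (\<Pi> j\<in>{k..<i}. {j * B<..<Suc j * B})" for x
      by (rule prod_holes_le) (use assms(1) k that in auto)
  qed (use V k a \<tau> in auto)
  also have "\<dots> \<le> (real (B - 1) * \<tau>) ^ c * (z ^ Suc c) ^ (n - c) * (\<Prod>j\<in>{k..<i}. 4 / (3 * a\<^sup>2))"
    using mult_power_diff_le[OF r2 c a(1,2)] q0 \<tau>(1) z0
    by (intro mult_left_mono prod_mono conjI mult_nonneg_nonneg zero_le_power) auto
  also have "(\<Prod>j\<in>{k..<i}. 4 / (3 * a\<^sup>2)) = (4 / (3 * a\<^sup>2)) ^ c" by (simp add: c_def)
  finally have "D ^ Suc c * measure_pmf.prob (Pi_pmf V 0 (\<lambda>_. \<rho>)) (chain_event B k i es)
      \<le> D ^ Suc c * ((real (B - 1) * \<tau>) ^ c * (z ^ Suc c) ^ (n - c) * (4 / (3 * a\<^sup>2)) ^ c)"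
    using D(1) by (intro mult_left_mono) auto
  also have "\<dots> = (D * z ^ (n - c)) ^ Suc c * (real (B - 1) * \<tau> * (4 / (3 * a\<^sup>2))) ^ c"
  proof -
    have "(z ^ Suc c) ^ (n - c) = (z ^ (n - c)) ^ Suc c"
      by (simp only: power_mult[symmetric] mult.commute)
    then show ?thesis by (simp only: power_mult_distrib mult_ac)
  qed
  also have "\<dots> \<le> (1 / (12 * real r ^ 3) * Y) ^ Suc c * (4 / 3 * real r ^ 3 / X) ^ c"
  proof (rule mult_mono)
    have F: "D * z ^ (n - c) \<le> 1 / (12 * real r ^ 3) * Y"
      unfolding z_def Y_def by (rule edge_factor_le[OF D(2) c])
    have "0 \<le> D * z ^ (n - c)" using D(1) z0 by simp
    with F show "(D * z ^ (n - c)) ^ Suc c \<le> (1 / (12 * real r ^ 3) * Y) ^ Suc c" by (rule power_mono)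
    have "0 \<le> real (B - 1) * \<tau> * (4 / (3 * a\<^sup>2))" by (rule mult_nonneg_nonneg[OF m0 less_imp_le[OF a0]])
    then show "0 \<le> (real (B - 1) * \<tau> * (4 / (3 * a\<^sup>2))) ^ c"
      and "(real (B - 1) * \<tau> * (4 / (3 * a\<^sup>2))) ^ c \<le> (4 / 3 * real r ^ 3 / X) ^ c"
      by (rule zero_le_power, intro power_mono link_factor_le)
    show "0 \<le> (1 / (12 * real r ^ 3) * Y) ^ Suc c"
      by (intro zero_le_power mult_nonneg_nonneg) (auto simp: Y_def)
  qed
  also have "\<dots> \<le> (1 / (12 * real r ^ 3)) ^ Suc c * X ^ c * (4 / 3 * real r ^ 3 / X) ^ c"
  proof (intro mult_right_mono)
    \<comment> \<open>For a chain through all colours \<open>Suc c = r\<close> and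
      \<open>\<beta> * r = c\<close>, so the powers of \<open>X\<close> from edges and links cancel
      exactly.\<close>
    have "Y ^ Suc c \<le> X ^ c"
    proof (cases "k = 1 \<and> i = r")
      case True
      then have "Suc c = r" using r2 by (simp add: c_def)
      have "Y ^ Suc c = (X powr \<beta>) powr real r"
        using True X_gt \<open>Suc c = r\<close> by (simp add: Y_def powr_realpow)
      also have "\<dots> = X powr real c"
        using r_gt \<open>Suc c = r\<close> by (auto simp: powr_powr \<beta>_def)
      also have "\<dots> = X ^ c" using X_gt by (simp add: powr_realpow)
      finally show ?thesis by simp
    next
      case False
      then have "Y = 1" unfolding Y_def by (rule if_not_P)
      then show ?thesis using X_gt by (simp add: one_le_power)
    qed
    then show "(1 / (12 * real r ^ 3) * Y) ^ Suc c \<le> (1 / (12 * real r ^ 3)) ^ Suc c * X ^ c"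
      unfolding power_mult_distrib by (intro mult_left_mono) auto
  qed (use X_gt in auto)
  also have "\<dots> = 1 / (12 * real r ^ 3) * (1 / (12 * real r ^ 3) * X * (4 / 3 * real r ^ 3 / X)) ^ c"
    by (simp only: power_mult_distrib power_Suc mult_ac)
  also have "1 / (12 * real r ^ 3) * X * (4 / 3 * real r ^ 3 / X) = 1 / 9"
    using X_gt r_gt by (simp add: field_simps)
  also have "1 / (12 * real r ^ 3) * (1 / 9) ^ c \<le> 1 / real r ^ 3 * (1 / 9) ^ Suc c"
    using r_gt by (simp add: field_simps)
  finally show ?thesis by (simp only: c_def)
qed

end

subsection \<open>The degree bound\<close>

lemma sum_ninth_powers_le:
  assumes "k \<le> m"
  shows "(\<Sum>i\<in>{k..m}. (1 / 9 :: real) ^ Suc (i - k)) \<le> 1 / 8"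
proof -
  have "(\<Sum>i\<in>{k..m}. (1 / 9 :: real) ^ Suc (i - k)) = 1 / 8 * (1 - (1 / 9) ^ Suc (m - k))"
    using assms
  proof (induction m rule: dec_induct)
    case (step m)
    then show ?case by (simp add: Suc_diff_le)
  qed simp
  also have "\<dots> \<le> 1 / 8" by simp
  finally show ?thesis .
qed

context chain_parameters
begin

text \<open>The local lemma for the events of all chains, neighbours being chains with a common
  vertex. The factor \<open>1 / r ^ 3\<close> pays for the at most \<open>r\<^sup>2\<close> pairs of
  indices at which two chains can meet and for the \<open>r\<close> values of \<open>k'\<close>; the
  geometric series in the length leaves \<open>1 / 8\<close>.\<close>

lemma panchromatic_colorable_if_small_degree:
  assumes H: "hypergraph V E" and U: "uniform n E"
    and deg: "\<And>A. A \<in> E \<Longrightarrow> edge_degree E A \<le> D"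
    and D: "real D \<le> 1 / (40 * real r ^ 3) * X powr \<beta> * (real r / (real r - 1)) ^ n"
  shows "panchromatic_colorable V E r"
proof -
  have V: "finite V" "E \<subseteq> Pow V" and cardE: "\<And>e. e \<in> E \<Longrightarrow> card e = n"
    using H U by (auto simp: hypergraph_def uniform_def)
  have finE: "finite E" using V finite_subset by auto
  have fin: "finite e" if "e \<in> E" for e using that V finite_subset by blast
  have ne: "e \<noteq> {}" if "e \<in> E" for e using cardE[OF that] n3 by auto
  obtain \<rho> where \<rho>: "chain_weights B r a \<tau> \<rho>" using exists_positions by blast
  interpret chain_weights B r a \<tau> \<rho> by fact
  define P where "P = Pi_pmf V 0 (\<lambda>_. \<rho>)"
  define I where "I = (SIGMA k:{1..r}. SIGMA i:{k..r}. edge_chains E k i)"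
  define A where "A = (\<lambda>(k, i, es). chain_event B k i es :: ('a \<Rightarrow> nat) set)"
  define supp where "supp = (\<lambda>(k, i, es). \<Union>j\<in>{k..i::nat}. es j :: 'a set)"
  define N where "N x y \<longleftrightarrow> supp x \<inter> supp y \<noteq> {}" for x y
  have finI: "finite I"
    unfolding I_def by (intro finite_SigmaI finite_edge_chains finE) auto
  have inI: "(k, i, es) \<in> I \<longleftrightarrow> 1 \<le> k \<and> k \<le> i \<and> i \<le> r \<and> es \<in> edge_chains E k i" for k i es
    by (auto simp: I_def)
  have esE: "es j \<in> E" if "es \<in> edge_chains E k i" "j \<in> {k..i}" for es k i j
    using that by (auto simp: edge_chains_def)
  have suppV: "supp x \<subseteq> V" if "x \<in> I" for x
  proof -
    obtain k i es where xe: "x = (k, i, es)" by (cases x)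
    have "es j \<subseteq> V" if "j \<in> {k..i}" for j
      using \<open>x \<in> I\<close> esE[of es k i j] that V(2) unfolding xe inI by blast
    then show ?thesis unfolding xe supp_def by fastforce
  qed
  have cong: "\<sigma> \<in> A x \<longleftrightarrow> \<sigma>' \<in> A x" if "\<And>u. u \<in> supp x \<Longrightarrow> \<sigma> u = \<sigma>' u" for x \<sigma> \<sigma>'
  proof -
    obtain k i es where xe: "x = (k, i, es)" by (cases x)
    show ?thesis
      unfolding xe A_def prod.case by (rule chain_event_cong) (use that in \<open>simp add: xe supp_def\<close>)
  qed
  have "\<exists>\<sigma>\<in>set_pmf P. \<forall>x\<in>I. \<sigma> \<notin> A x"
  proof (rule lovasz_local_lemma[where N = N, OF finI])
    fix x assume x: "x \<in> I"
    obtain k i es where xe: "x = (k, i, es)" by (cases x)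
    have k: "1 \<le> k" "k \<le> i" "i \<le> r" and es: "es \<in> edge_chains E k i"
      using x xe inI by auto
    have ek: "es k \<in> E" using esE[OF es] k by auto
    show "N x x" using ne[OF ek] k by (auto simp: N_def supp_def xe)
    show "(\<Sum>y | y \<in> I \<and> N x y. measure_pmf.prob P (A y)) \<le> 1 / 4"
    proof -
      \<comment> \<open>The edge meets itself, so \<open>D\<close> is positive and can be divided
        by.\<close>
      have "es k \<in> {F \<in> E. F \<inter> es k \<noteq> {}}" using ek ne by auto
      then have "0 < edge_degree E (es k)"
        unfolding edge_degree_def using finE by (subst card_gt_0_iff) auto
      then have D0: "0 < D" using deg[OF ek] by simp
      define M where "M k' i' = {es' \<in> edge_chains E k' i'. N x (k', i', es')}" for k' i'
      have finM: "finite (M k' i')" for k' i'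
        unfolding M_def using finite_edge_chains[OF finE] by simp
      have card: "real (card (M k' i')) \<le> real r * real r * real D ^ Suc (i' - k')"
        if "1 \<le> k'" "k' \<le> i'" "i' \<le> r" for k' i'
      proof -
        have "M k' i' \<subseteq> (\<Union>(j, j')\<in>{k..i} \<times> {k'..i'}. {es' \<in> edge_chains E k' i'. es' j' \<inter> es j \<noteq> {}})"
          by (auto simp: M_def N_def supp_def xe)
        then have "card (M k' i') \<le> card (\<Union>(j, j')\<in>{k..i} \<times> {k'..i'}. {es' \<in> edge_chains E k' i'. es' j' \<inter> es j \<noteq> {}})"
          using finite_edge_chains[OF finE] by (intro card_mono) auto
        also have "\<dots> \<le> (\<Sum>(j, j')\<in>{k..i} \<times> {k'..i'}. card {es' \<in> edge_chains E k' i'. es' j' \<inter> es j \<noteq> {}})"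
          unfolding case_prod_beta by (rule card_UN_le) simp
        also have "\<dots> \<le> (\<Sum>(j, j')\<in>{k..i} \<times> {k'..i'}. D ^ Suc (i' - k'))"
          unfolding case_prod_beta
          by (intro sum_mono card_edge_chains_meeting finE deg esE[OF es]) auto
        also have "\<dots> = card {k..i} * card {k'..i'} * D ^ Suc (i' - k')"
          by (simp add: case_prod_beta card_cartesian_product)
        also have "\<dots> \<le> r * r * D ^ Suc (i' - k')"
          using k that by (intro mult_le_mono) auto
        finally show ?thesis by (metis of_nat_le_iff of_nat_mult of_nat_power)
      qed
      have inner: "(\<Sum>es'\<in>M k' i'. measure_pmf.prob P (A (k', i', es'))) \<le> 1 / real r * (1 / 9) ^ Suc (i' - k')"
        if k': "1 \<le> k'" "k' \<le> i'" "i' \<le> r" for k' i'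
      proof -
        define b where "b = 1 / real r ^ 3 * (1 / 9 :: real) ^ Suc (i' - k')"
        have Dp: "0 < real D ^ Suc (i' - k')" using D0 by simp
        have "(\<Sum>es'\<in>M k' i'. measure_pmf.prob P (A (k', i', es'))) \<le> (\<Sum>es'\<in>M k' i'. b / real D ^ Suc (i' - k'))"
        proof (rule sum_mono)
          fix es' assume "es' \<in> M k' i'"
          then have "es' \<in> edge_chains E k' i'" by (simp add: M_def)
          then have "real D ^ Suc (i' - k') * measure_pmf.prob P (A (k', i', es')) \<le> b"
            unfolding P_def A_def b_def prod.case
            using V cardE k' D by (intro degree_power_chain_prob_le[OF \<rho>]) auto
          then show "measure_pmf.prob P (A (k', i', es')) \<le> b / real D ^ Suc (i' - k')"
            using Dp by (simp only: pos_le_divide_eq mult.commute)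
        qed
        also have "\<dots> = real (card (M k' i')) * (b / real D ^ Suc (i' - k'))" by simp
        also have "\<dots> \<le> (real r * real r * real D ^ Suc (i' - k')) * (b / real D ^ Suc (i' - k'))"
          using card[OF k'] by (intro mult_right_mono) (auto simp: b_def)
        also have "\<dots> = real r * real r * b" using D0 by simp
        also have "\<dots> = 1 / real r * (1 / 9) ^ Suc (i' - k')"
          using r_gt by (simp add: b_def power3_eq_cube)
        finally show ?thesis .
      qed
      have "{y \<in> I. N x y} = (SIGMA k':{1..r}. SIGMA i':{k'..r}. M k' i')"
        by (auto simp: I_def M_def)
      then have "(\<Sum>y | y \<in> I \<and> N x y. measure_pmf.prob P (A y))
          = (\<Sum>k'\<in>{1..r}. \<Sum>i'\<in>{k'..r}. \<Sum>es'\<in>M k' i'. measure_pmf.prob P (A (k', i', es')))"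
        by (simp add: sum.Sigma finM split_def)
      also have "\<dots> \<le> (\<Sum>k'\<in>{1..r}. \<Sum>i'\<in>{k'..r}. 1 / real r * (1 / 9) ^ Suc (i' - k'))"
        by (intro sum_mono inner) auto
      also have "\<dots> \<le> (\<Sum>k'\<in>{1..r}. 1 / real r * (1 / 8))"
        unfolding sum_distrib_left[symmetric]
        by (intro sum_mono mult_left_mono sum_ninth_powers_le) auto
      also have "\<dots> \<le> 1 / 4" using r_gt by simp
      finally show ?thesis .
    qed
    fix S assume S: "S \<subseteq> I" "\<And>y. y \<in> S \<Longrightarrow> \<not> N x y"
    show "measure_pmf.prob P (A x \<inter> {\<sigma>. \<forall>y\<in>S. \<sigma> \<notin> A y})
        = measure_pmf.prob P (A x) * measure_pmf.prob P {\<sigma>. \<forall>y\<in>S. \<sigma> \<notin> A y}"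
      unfolding P_def
    proof (rule prob_Pi_pmf_Int_indep[OF V(1) suppV[OF x]])
      show "\<sigma> \<in> A x \<longleftrightarrow> \<sigma>' \<in> A x" if "\<And>u. u \<in> supp x \<Longrightarrow> \<sigma> u = \<sigma>' u" for \<sigma> \<sigma>'
        using that by (rule cong)
      show "\<sigma> \<in> {\<sigma>. \<forall>y\<in>S. \<sigma> \<notin> A y} \<longleftrightarrow> \<sigma>' \<in> {\<sigma>. \<forall>y\<in>S. \<sigma> \<notin> A y}"
        if eq: "\<And>u. u \<in> V - supp x \<Longrightarrow> \<sigma> u = \<sigma>' u" for \<sigma> \<sigma>'
      proof -
        have "\<sigma> \<in> A y \<longleftrightarrow> \<sigma>' \<in> A y" if "y \<in> S" for y
        proof (rule cong)
          fix u assume "u \<in> supp y"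
          then have "u \<in> V - supp x" using suppV[of y] S(1) S(2)[OF that] that unfolding N_def by blast
          then show "\<sigma> u = \<sigma>' u" by (rule eq)
        qed
        then show ?thesis by simp
      qed
    qed
  qed
  then obtain \<sigma> where \<sigma>: "\<sigma> \<in> set_pmf P" "\<And>x. x \<in> I \<Longrightarrow> \<sigma> \<notin> A x" by blast
  have range: "\<sigma> v \<in> {B..r * B}" if "v \<in> V" for v
    using \<sigma>(1) support that V(1) by (auto simp: P_def set_Pi_pmf PiE_dflt_def)
  have "panchromatic E r (chain_coloring B E \<sigma>)"
  proof (rule panchromatic_chain_coloring)
    fix k i es assume "1 \<le> k" "k \<le> i" "i \<le> r" "es \<in> edge_chains E k i"
    then have "(k, i, es) \<in> I" by (simp add: inI)
    then show "\<sigma> \<notin> chain_event B k i es" using \<sigma>(2) by (force simp: A_def)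
  qed (use fin in \<open>auto simp: B_def\<close>)
  moreover have "chain_coloring B E \<sigma> \<in> V \<rightarrow> {1..r}"
    using chain_coloring_range[of B \<sigma> _ r E] range by (auto simp: B_def)
  ultimately show ?thesis unfolding panchromatic_colorable_def by blast
qed

end

text \<open>Ensures that the minimum in \<open>d\<close> is attained. Among \<open>2 * n\<close>
  vertices, those of colour 1 or the others contain an \<open>n\<close>-subset, and this edge misses
  colour 2 or colour 1.\<close>

lemma exists_not_panchromatic_colorable:
  assumes "2 \<le> r"
  shows "\<exists>(V :: nat set) E. hypergraph V E \<and> uniform n E \<and> \<not> panchromatic_colorable V E r"
proof -
  define V where "V = {..<2 * n}"
  define E where "E = {A. A \<subseteq> V \<and> card A = n}"
  have "\<not> panchromatic_colorable V E r"
  proof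
    assume "panchromatic_colorable V E r"
    then obtain f where f: "panchromatic E r f" by (auto simp: panchromatic_colorable_def)
    define V1 where "V1 = {v \<in> V. f v = 1}"
    define V2 where "V2 = {v \<in> V. f v \<noteq> 1}"
    have "V = V1 \<union> V2" "V1 \<inter> V2 = {}" "finite V1" "finite V2" by (auto simp: V1_def V2_def V_def)
    then have "card V = card V1 + card V2" using card_Un_disjoint[of V1 V2] by metis
    then have "card V1 + card V2 = 2 * n" by (simp add: V_def)
    then consider "n \<le> card V1" | "n \<le> card V2" by linarith
    then show False
    proof cases
      case 1
      then obtain A where A: "A \<subseteq> V1" "card A = n" by (meson obtain_subset_with_card_n)
      then have "A \<in> E" by (auto simp: E_def V1_def)
      then obtain v where "v \<in> A" "f v = 2"
        using f assms unfolding panchromatic_def by (metis atLeastAtMost_iff one_le_numeral)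
      then show False using A by (auto simp: V1_def)
    next
      case 2
      then obtain A where A: "A \<subseteq> V2" "card A = n" by (meson obtain_subset_with_card_n)
      then have "A \<in> E" by (auto simp: E_def V2_def)
      then obtain v where "v \<in> A" "f v = 1"
        using f assms unfolding panchromatic_def by (metis atLeastAtMost_iff one_le_numeral order_trans order_refl)
      then show False using A by (auto simp: V2_def)
    qed
  qed
  moreover have "hypergraph V E" "uniform n E" by (auto simp: hypergraph_def uniform_def E_def V_def)
  ultimately show ?thesis by blast
qed

theorem theorem2:
  fixes n r :: nat
  assumes "n \<ge> 3" and "r \<ge> 2"
    and "real r < root 3 (real n / (100 * ln (real n)))"
  shows "real (d n r) \<ge> 1 / (40 * real r ^ 3)
           * (real n / ln (real n)) powr ((real r - 1) / real r)
           * (real r / (real r - 1)) ^ n"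
proof -
  have ln0: "0 < ln (real n)" using assms(1) by simp
  have "real r ^ 3 < root 3 (real n / (100 * ln (real n))) ^ 3"
    using assms(3) by (intro power_strict_mono) auto
  also have "\<dots> = real n / (100 * ln (real n))"
    using ln0 by (intro real_root_pow_pos2) auto
  finally have "100 * real r ^ 3 < real n / ln (real n)"
    using ln0 by (simp add: field_simps)
  then interpret chain_parameters n r using assms by unfold_locales auto
  have "\<exists>D (V :: nat set) E. hypergraph V E \<and> uniform n E \<and>
      \<not> panchromatic_colorable V E r \<and> max_edge_degree E = D"
    using exists_not_panchromatic_colorable[OF assms(2), of n] by blast
  from LeastI_ex[OF this] obtain V :: "nat set" and E where
    H: "hypergraph V E" "uniform n E" "\<not> panchromatic_colorable V E r" "max_edge_degree E = d n r"
    unfolding d_def by blast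
  have "finite E" using H(1) by (auto simp: hypergraph_def intro: finite_subset)
  then have "edge_degree E A \<le> d n r" if "A \<in> E" for A
    using that unfolding H(4)[symmetric] max_edge_degree_def by (intro Max_ge) auto
  \<comment> \<open>The hypergraph attaining the minimum is not colourable, so its degree must
    exceed the bound.\<close>
  then have "\<not> real (d n r) \<le> 1 / (40 * real r ^ 3) * X powr \<beta> * (real r / (real r - 1)) ^ n"
    using panchromatic_colorable_if_small_degree[OF H(1,2)] H(3) by blast
  then show ?thesis by (simp add: X_def \<beta>_def)
qed

end
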